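(* Let $m\in\mathbb N$. The semigroup $\mathcal H_m(\cdot)$ on $X_m=\mathbb C^{2m+1}$ generated by the truncated deterministic system $$\frac{du}{dt}=(\lambda+i\mu)\Lambda_mu-(\gamma+i\beta)u-(k+i\nu)|u|^pu+g^m$$ has a global attractor $\mathcal A_m$ in $X_m$. Moreover, with $\mathcal A_m^a(\omega)$, $a\in(0,a^*]$, denoting the random $\tilde{\mathcal D}_m$-attractor of the random dynamical system $\Xi_m^a$ on $X_m$ generated by $$\frac{dU}{dt}=(\lambda+i\mu)\Lambda_mU-(\gamma+i\beta)U-(k+i\nu)e^{paz(\theta_t\omega)}|U|^pU+e^{-az(\theta_t\omega)}g^m+az(\theta_t\omega)U,$$ one has $$\lim_{a\to0}\mathrm{dist}_{X_m}\big(\mathcal A_m^a(\omega),\mathcal A_m\big)=0,\qquad\forall\,\omega\in\Omega.$$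
   Context: Parameters: $\lambda,\gamma,k,p>0$, $\mu,\beta,\nu\in\mathbb R$, $\gamma>4\lambda$; $g=(g_j)_{j\in\mathbb Z}$ is a fixed complex sequence with $\sum_j|g_j|^{(p+2)/(p+1)}<\infty$ (hence $g\in\ell^2$); $a>0$ is the noise intensity and $a^*>0$ a fixed upper bound for it. $X_m=\mathbb C^{2m+1}$, elements $z=(z_j)_{|j|\le m}$, Euclidean norm $\|\cdot\|$; $|z|^pz=(|z_j|^pz_j)_{|j|\le m}$; $g^m=(g_j)_{|j|\le m}$; $(\Lambda_mz)_j=-z_{j-1}+2z_j-z_{j+1}$ for $|j|\le m$ with $z_{-m-1}=z_m$, $z_{m+1}=z_{-m}$. $\mathrm{dist}_{X_m}(A,B)=\sup_{a\in A}\inf_{b\in B}\|a-b\|$. $\mathcal H_m(t)u_0$ is the value at time $t\ge0$ of the solution of the truncated deterministic system with initial value $u_0\in X_m$; its global attractor is a compact set $\mathcal A_m\subset X_m$ with $\mathcal H_m(t)\mathcal A_m=\mathcal A_m$ for all $t\ge0$ which attracts every bounded subset of $X_m$ in $\mathrm{dist}_{X_m}$ as $t\to\infty$. Probability space: $\Omega=\{\omega\in C(\mathbb R,\mathbb R):\omega(0)=0\}$ with the Borel $\sigma$-algebra $\mathcal F$ of the compact-open topology, two-sided Wiener measure $\mathbb P$, and shifts $\theta_t\omega(\cdot)=\omega(t+\cdot)-\omega(t)$. The Ornstein–Uhlenbeck process is $z(\theta_t\omega)=-\int_{-\infty}^0e^s(\theta_t\omega)(s)\,ds$; $\Omega$ is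 restricted to a $\theta$-invariant set of full measure on which $t\mapsto z(\theta_t\omega)$ is continuous, $\lim_{t\to\pm\infty}|z(\theta_t\omega)|/|t|=0$ and $\lim_{t\to\pm\infty}\frac1t\int_0^tz(\theta_s\omega)\,ds=0$. $\Xi^a_m(t,\omega)U_0$ is the value at time $t\ge0$ of the solution of the random equation with $U(0)=U_0\in X_m$. $\tilde{\mathcal D}_m$ is the universe of closed random sets $\mathcal D=\{\mathcal D(\omega)\}$ in $X_m$ with $\lim_{t\to+\infty}e^{-\rho t}\sup_{\phi\in\mathcal D(\theta_{-t}\omega)}\|\phi\|=0$ for all $\rho>0$, $\omega\in\Omega$. The random $\tilde{\mathcal D}_m$-attractor is the random compact set $\{\mathcal A_m^a(\omega)\}\in\tilde{\mathcal D}_m$ with $\Xi_m^a(t,\omega)\mathcal A_m^a(\omega)=\mathcal A_m^a(\theta_t\omega)$ for all $t\ge0$, $\omega\in\Omega$, and $\lim_{t\to\infty}\mathrm{dist}_{X_m}(\Xi_m^a(t,\theta_{-t}\omega)\mathcal D(\theta_{-t}\omega),\mathcal A_m^a(\omega))=0$ for all $\mathcal D\in\tilde{\mathcal D}_m$, $\omega\in\Omega$. *)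

theory Defs
  imports "HOL-Probability.Probability"
begin

section \<open>Truncated lattice systems\<close>

text \<open>
  The space \<open>X\<^sub>m\<close> of vectors \<open>(z\<^sub>j)\<close> with \<open>\<bar>j\<bar> \<le> m\<close> is rendered as \<^typ>\<open>complex ^ 'n\<close>, together with an
  enumeration \<open>\<iota> :: 'n \<Rightarrow> int\<close> that is a bijection onto \<open>{-m..m}\<close>; the coordinate \<open>z\<^sub>j\<close> is
  \<open>z $ inv \<iota> j\<close>. The norm of the type is the Euclidean one.
\<close>

text \<open>Coordinates for \<open>-m-1 \<le> j \<le> m+1\<close>, with \<open>z\<^bsub>-m-1\<^esub> = z\<^sub>m\<close> and \<open>z\<^bsub>m+1\<^esub> = z\<^bsub>-m\<^esub>\<close>.\<close>

definition coord :: "('n::finite \<Rightarrow> int) \<Rightarrow> nat \<Rightarrow> complex ^ 'n \<Rightarrow> int \<Rightarrow> complex" where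
  "coord \<iota> m z j =
     z $ inv \<iota> (if j = - int m - 1 then int m else if j = int m + 1 then - int m else j)"

definition lattice_Lambda :: "('n::finite \<Rightarrow> int) \<Rightarrow> nat \<Rightarrow> complex ^ 'n \<Rightarrow> complex ^ 'n" where
  "lattice_Lambda \<iota> m z =
     (\<chi> i. - coord \<iota> m z (\<iota> i - 1) + 2 * coord \<iota> m z (\<iota> i) - coord \<iota> m z (\<iota> i + 1))"

definition power_nonlin :: "real \<Rightarrow> complex ^ 'n \<Rightarrow> complex ^ 'n" where
  "power_nonlin p z = (\<chi> i. of_real (norm (z $ i) powr p) * z $ i)"

definition truncate_seq :: "('n::finite \<Rightarrow> int) \<Rightarrow> (int \<Rightarrow> complex) \<Rightarrow> complex ^ 'n" where
  "truncate_seq \<iota> g = (\<chi> i. g (\<iota> i))"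

definition det_field ::
  "('n::finite \<Rightarrow> int) \<Rightarrow> nat \<Rightarrow> real \<Rightarrow> real \<Rightarrow> real \<Rightarrow> real \<Rightarrow> real \<Rightarrow> real \<Rightarrow> real \<Rightarrow> (int \<Rightarrow> complex)
     \<Rightarrow> complex ^ 'n \<Rightarrow> complex ^ 'n" where
  "det_field \<iota> m lam \<mu> \<gamma> \<beta> k \<nu> p g u =
     Complex lam \<mu> *s lattice_Lambda \<iota> m u - Complex \<gamma> \<beta> *s u
       - Complex k \<nu> *s power_nonlin p u + truncate_seq \<iota> g"

text \<open>The random vector field, where the real number \<open>\<zeta>\<close> stands for \<open>z(\<theta>\<^sub>t\<omega>)\<close>.\<close>

definition rand_field ::
  "('n::finite \<Rightarrow> int) \<Rightarrow> nat \<Rightarrow> real \<Rightarrow> real \<Rightarrow> real \<Rightarrow> real \<Rightarrow> real \<Rightarrow> real \<Rightarrow> real \<Rightarrow> (int \<Rightarrow> complex)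
     \<Rightarrow> real \<Rightarrow> real \<Rightarrow> complex ^ 'n \<Rightarrow> complex ^ 'n" where
  "rand_field \<iota> m lam \<mu> \<gamma> \<beta> k \<nu> p g a \<zeta> U =
     Complex lam \<mu> *s lattice_Lambda \<iota> m U - Complex \<gamma> \<beta> *s U
       - Complex k \<nu> *s (exp (p * a * \<zeta>) *\<^sub>R power_nonlin p U)
       + exp (- a * \<zeta>) *\<^sub>R truncate_seq \<iota> g + (a * \<zeta>) *\<^sub>R U"

section \<open>Solution operators of initial value problems\<close>

definition ivp_solution ::
  "(real \<Rightarrow> 'a \<Rightarrow> 'a) \<Rightarrow> 'a \<Rightarrow> (real \<Rightarrow> 'a::real_normed_vector) \<Rightarrow> bool" where
  "ivp_solution f x0 u \<longleftrightarrow>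
     u 0 = x0 \<and> (\<forall>t\<ge>0. (u has_vector_derivative f t (u t)) (at t within {0..}))"

text \<open>
  The description is over the value at time \<open>t\<close> and not over \<open>u\<close>, because the values of a solution at
  negative times are not determined.
\<close>

definition solution_op ::
  "(real \<Rightarrow> 'a \<Rightarrow> 'a) \<Rightarrow> real \<Rightarrow> 'a \<Rightarrow> 'a::real_normed_vector" where
  "solution_op f t x0 = (THE x. \<exists>u. ivp_solution f x0 u \<and> u t = x)"

definition det_semigroup ::
  "('n::finite \<Rightarrow> int) \<Rightarrow> nat \<Rightarrow> real \<Rightarrow> real \<Rightarrow> real \<Rightarrow> real \<Rightarrow> real \<Rightarrow> real \<Rightarrow> real \<Rightarrow> (int \<Rightarrow> complex)
     \<Rightarrow> real \<Rightarrow> complex ^ 'n \<Rightarrow> complex ^ 'n" where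
  "det_semigroup \<iota> m lam \<mu> \<gamma> \<beta> k \<nu> p g =
     solution_op (\<lambda>t. det_field \<iota> m lam \<mu> \<gamma> \<beta> k \<nu> p g)"

section \<open>Attractors\<close>

text \<open>
  Hausdorff semidistance. It takes values in \<^typ>\<open>ennreal\<close>, so that the supremum over the empty set
  is 0, the infimum over the empty set is \<open>\<infinity>\<close>, and unbounded sets are treated correctly.
  In particular an attractor below is automatically nonempty.
\<close>

definition semidist :: "'a::real_normed_vector set \<Rightarrow> 'a set \<Rightarrow> ennreal" where
  "semidist A B = (SUP a\<in>A. INF b\<in>B. ennreal (norm (a - b)))"

definition global_attractor :: "(real \<Rightarrow> 'a \<Rightarrow> 'a::real_normed_vector) \<Rightarrow> 'a set \<Rightarrow> bool" where
  "global_attractor S A \<longleftrightarrow>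
     compact A \<and> (\<forall>t\<ge>0. S t ` A = A) \<and>
     (\<forall>B. bounded B \<longrightarrow> ((\<lambda>t. semidist (S t ` B) A) \<longlongrightarrow> 0) at_top)"

section \<open>Two-sided Wiener space and the Ornstein-Uhlenbeck process\<close>

text \<open>The continuous paths vanishing at 0, with the topology induced by the compact-open topology.\<close>

definition path_topology :: "(real \<Rightarrow> real) topology" where
  "path_topology =
     subtopology
       (topology_generated_by
          {{\<omega>. continuous_on UNIV \<omega> \<and> \<omega> ` K \<subseteq> U} |K U. compact K \<and> open U})
       {\<omega>. \<omega> 0 = 0}"

definition path_borel :: "(real \<Rightarrow> real) measure" where
  "path_borel = sigma (topspace path_topology) {G. openin path_topology G}"

text \<open>
  Two-sided Wiener measure: the coordinate process, which starts at \<open>\<omega>(0) = 0\<close>, has independent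
  centred Gaussian increments on the whole line, with variance the length of the time interval.
\<close>

definition wiener_measure :: "(real \<Rightarrow> real) measure \<Rightarrow> bool" where
  "wiener_measure P \<longleftrightarrow>
     prob_space P \<and> space P = space path_borel \<and> sets P = sets path_borel \<and>
     (\<forall>s t. s < t \<longrightarrow>
        distributed P lborel (\<lambda>\<omega>. \<omega> t - \<omega> s) (\<lambda>x. ennreal (normal_density 0 (sqrt (t - s)) x))) \<and>
     (\<forall>n (\<tau>::nat \<Rightarrow> real). strict_mono_on {..n} \<tau> \<longrightarrow>
        prob_space.indep_vars P (\<lambda>_. borel) (\<lambda>i \<omega>. \<omega> (\<tau> (Suc i)) - \<omega> (\<tau> i)) {..<n})"

definition path_shift :: "real \<Rightarrow> (real \<Rightarrow> real) \<Rightarrow> real \<Rightarrow> real" where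
  "path_shift t \<omega> = (\<lambda>s. \<omega> (t + s) - \<omega> t)"

definition OU :: "(real \<Rightarrow> real) \<Rightarrow> real" where
  "OU \<omega> = - (LINT s:{..0}|lborel. exp s * \<omega> s)"

text \<open>
  The measurable, shift-invariant sets of full measure to which the path space may be restricted.
  The integrability condition says that the integral defining the Ornstein-Uhlenbeck process
  exists. The interval integral is oriented, which matters in the limit \<open>t \<rightarrow> -\<infinity>\<close>.
\<close>

definition admissible_paths :: "(real \<Rightarrow> real) measure \<Rightarrow> (real \<Rightarrow> real) set \<Rightarrow> bool" where
  "admissible_paths P \<Omega> \<longleftrightarrow>
     \<Omega> \<in> sets P \<and> emeasure P \<Omega> = 1 \<and> (\<forall>t. path_shift t ` \<Omega> = \<Omega>) \<and>
     (\<forall>\<omega>\<in>\<Omega>.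
        set_integrable lborel {..0} (\<lambda>s. exp s * \<omega> s) \<and>
        continuous_on UNIV (\<lambda>t. OU (path_shift t \<omega>)) \<and>
        (\<forall>F\<in>{at_top, at_bot}.
           ((\<lambda>t. \<bar>OU (path_shift t \<omega>)\<bar> / \<bar>t\<bar>) \<longlongrightarrow> 0) F \<and>
           ((\<lambda>t. 1 / t * (LBINT s=0..t. OU (path_shift s \<omega>))) \<longlongrightarrow> 0) F))"

section \<open>Random attractors\<close>

definition rand_cocycle ::
  "('n::finite \<Rightarrow> int) \<Rightarrow> nat \<Rightarrow> real \<Rightarrow> real \<Rightarrow> real \<Rightarrow> real \<Rightarrow> real \<Rightarrow> real \<Rightarrow> real \<Rightarrow> (int \<Rightarrow> complex)
     \<Rightarrow> real \<Rightarrow> real \<Rightarrow> (real \<Rightarrow> real) \<Rightarrow> complex ^ 'n \<Rightarrow> complex ^ 'n" where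
  "rand_cocycle \<iota> m lam \<mu> \<gamma> \<beta> k \<nu> p g a t \<omega> =
     solution_op (\<lambda>s. rand_field \<iota> m lam \<mu> \<gamma> \<beta> k \<nu> p g a (OU (path_shift s \<omega>))) t"

text \<open>
  Below, \<open>M\<close> is the (restricted) path space and \<open>space M\<close> its set of paths. Random sets are nonempty,
  which is what makes \<^const>\<open>infdist\<close> the distance to the set.
\<close>

definition closed_random_set ::
  "(real \<Rightarrow> real) measure \<Rightarrow> ((real \<Rightarrow> real) \<Rightarrow> 'a::real_normed_vector set) \<Rightarrow> bool" where
  "closed_random_set M D \<longleftrightarrow>
     (\<forall>\<omega>\<in>space M. closed (D \<omega>) \<and> D \<omega> \<noteq> {}) \<and>
     (\<forall>x. (\<lambda>\<omega>. infdist x (D \<omega>)) \<in> borel_measurable M)"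

definition tempered_universe ::
  "(real \<Rightarrow> real) measure \<Rightarrow> ((real \<Rightarrow> real) \<Rightarrow> 'a::real_normed_vector set) set" where
  "tempered_universe M =
     {D. closed_random_set M D \<and>
         (\<forall>\<rho>>0. \<forall>\<omega>\<in>space M.
            ((\<lambda>t. ennreal (exp (- \<rho> * t)) * (SUP \<phi>\<in>D (path_shift (- t) \<omega>). ennreal (norm \<phi>)))
               \<longlongrightarrow> 0) at_top)}"

definition random_attractor ::
  "(real \<Rightarrow> real) measure \<Rightarrow> (real \<Rightarrow> (real \<Rightarrow> real) \<Rightarrow> 'a \<Rightarrow> 'a)
     \<Rightarrow> ((real \<Rightarrow> real) \<Rightarrow> 'a::real_normed_vector set) \<Rightarrow> bool" where
  "random_attractor M \<Xi> A \<longleftrightarrow>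
     A \<in> tempered_universe M \<and>
     (\<forall>\<omega>\<in>space M. compact (A \<omega>)) \<and>
     (\<forall>t\<ge>0. \<forall>\<omega>\<in>space M. \<Xi> t \<omega> ` A \<omega> = A (path_shift t \<omega>)) \<and>
     (\<forall>D\<in>tempered_universe M. \<forall>\<omega>\<in>space M.
        ((\<lambda>t. semidist (\<Xi> t (path_shift (- t) \<omega>) ` D (path_shift (- t) \<omega>)) (A \<omega>))
           \<longlongrightarrow> 0) at_top)"

end

theory Submission
  imports Defs
begin

text \<open>
  The family of fields \<open>field b\<close> contains the deterministic field as \<open>b = 0\<close> and the random field as
  \<open>b = a * z(\<theta>\<^sub>t\<omega>)\<close>. Taking the inner product of the equation with the solution, the nonlinear term has a
  good sign, and the Laplacian contributes at most \<open>4 * lam\<close>, so that with \<open>gap = \<gamma> - 4 * lam\<close> the squared norm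
  decays at rate \<open>gap - 2 * b\<close> up to a bounded forcing (\<open>energy_estimate\<close>). Together with the local Lipschitz
  property this yields unique global solutions (\<open>exists_ivp_solution\<close>, \<open>solutions_agree\<close>), so that the definite
  descriptions of the semigroup and of the cocycle denote values of actual solutions.

  For \<open>b = 0\<close> a ball is absorbing and positively invariant. In finite dimension it is compact, and the
  intersection of its images is the global attractor (\<open>semigroup_global_attractor\<close>).

  Upper semicontinuity rests on two facts. First, for a fixed path and all small \<open>a\<close>, the random attractors
  lie in one ball, whose radius depends neither on \<open>a\<close> nor on the path
  (\<open>random_attractors_uniformly_bounded\<close>): pulling a point of the attractor back to a remote time \<open>-t\<close>, the factor
  \<open>exp (- gap * t)\<close> beats the tempered size of the starting point, and the noise contributes only
  \<open>exp\<close> of \<open>a\<close> times a sublinear function of \<open>t\<close>. Second, over a fixed time the cocycle converges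
  to the semigroup uniformly on balls as \<open>a \<rightarrow> 0\<close> (\<open>flow_tends_to_semiflow\<close>). Since the attractor at \<open>\<omega>\<close> is the image
  of the attractor at \<open>\<theta>\<^bsub>-T\<^esub>\<omega>\<close>, it lies near the image of the ball under the semigroup at time \<open>T\<close>, which is
  near the global attractor once \<open>T\<close> is large.
\<close>

section \<open>Differential inequalities and comparison of solutions\<close>

lemma deriv_le_imp_increment_le:
  fixes v w :: "real \<Rightarrow> real"
  assumes "a \<le> b"
    and v: "\<And>t. t \<in> {a..b} \<Longrightarrow> (v has_real_derivative v' t) (at t within {a..b})"
    and w: "\<And>t. t \<in> {a..b} \<Longrightarrow> (w has_real_derivative w' t) (at t within {a..b})"
    and le: "\<And>t. t \<in> {a..b} \<Longrightarrow> v' t \<le> w' t"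
  shows "v b - v a \<le> w b - w a"
proof -
  have d: "((\<lambda>t. v t - w t) has_real_derivative v' t - w' t) (at t within {a..b})"
    if "t \<in> {a..b}" for t
    using v[OF that] w[OF that] by (rule DERIV_diff)
  have "v b - w b \<le> v a - w a"
  proof (rule DERIV_nonpos_imp_decreasing_open[OF \<open>a \<le> b\<close>])
    show "continuous_on {a..b} (\<lambda>t. v t - w t)"
      by (rule DERIV_continuous_on[OF d])
    fix t assume t: "a < t" "t < b"
    have "((\<lambda>t. v t - w t) has_real_derivative v' t - w' t) (at t)"
      using d[of t] t by (simp add: at_within_Icc_at)
    moreover have "v' t - w' t \<le> 0" using le[of t] t by simp
    ultimately show "\<exists>y. ((\<lambda>t. v t - w t) has_real_derivative y) (at t) \<and> y \<le> 0" by blast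
  qed
  then show ?thesis by simp
qed

text \<open>
  Allowing \<open>c < 0\<close> makes the lemma serve two purposes: with \<open>c > 0\<close> it bounds growth on a bounded time
  interval, with \<open>c < 0\<close> it gives exponential decay towards the equilibrium value \<open>- d / c\<close>.
  The function \<open>(w + d / c) exp (- c * t)\<close> is nonincreasing.
\<close>

lemma gronwall:
  fixes w :: "real \<Rightarrow> real"
  assumes "0 \<le> T" and "c \<noteq> 0"
    and w: "\<And>t. t \<in> {0..T} \<Longrightarrow> (w has_real_derivative w' t) (at t within {0..T})"
    and le: "\<And>t. t \<in> {0..T} \<Longrightarrow> w' t \<le> c * w t + d"
  shows "w T + d / c \<le> (w 0 + d / c) * exp (c * T)"
proof -
  have "(w T + d / c) * exp (- c * T) - (w 0 + d / c) * exp (- c * 0) \<le> 0 - 0"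
  proof (rule deriv_le_imp_increment_le[where w = "\<lambda>_. 0" and w' = "\<lambda>_. 0"
        and v = "\<lambda>t. (w t + d / c) * exp (- c * t)"
        and v' = "\<lambda>t. (w' t - (c * w t + d)) * exp (- c * t)"])
    fix t assume t: "t \<in> {0..T}"
    show "((\<lambda>t. (w t + d / c) * exp (- c * t)) has_real_derivative
        (w' t - (c * w t + d)) * exp (- c * t)) (at t within {0..T})"
      using \<open>c \<noteq> 0\<close> by (auto intro!: derivative_eq_intros w[OF t] simp: field_simps)
    show "(w' t - (c * w t + d)) * exp (- c * t) \<le> 0"
      using le[OF t] by (simp add: mult_le_0_iff)
  qed (use assms in auto)
  then have "(w T + d / c) * exp (- c * T) \<le> w 0 + d / c" by simp
  then have "(w T + d / c) * exp (- c * T) * exp (c * T) \<le> (w 0 + d / c) * exp (c * T)"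
    by (rule mult_right_mono) simp
  then show ?thesis by (simp add: mult.assoc flip: exp_add)
qed

definition solves_on :: "(real \<Rightarrow> 'a \<Rightarrow> 'a) \<Rightarrow> real \<Rightarrow> (real \<Rightarrow> 'a::real_normed_vector) \<Rightarrow> bool" where
  "solves_on f T u \<longleftrightarrow> (\<forall>t\<in>{0..T}. (u has_vector_derivative f t (u t)) (at t within {0..T}))"

lemma solves_on_subinterval:
  assumes "solves_on f T u" "S \<le> T"
  shows "solves_on f S u"
  unfolding solves_on_def
proof
  fix t assume "t \<in> {0..S}"
  then have "t \<in> {0..T}" using assms(2) by simp
  then have "(u has_vector_derivative f t (u t)) (at t within {0..T})"
    using assms(1) unfolding solves_on_def by blast
  then show "(u has_vector_derivative f t (u t)) (at t within {0..S})"
    by (rule has_vector_derivative_within_subset) (use assms(2) in simp)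
qed

lemma ivp_solution_solves_on:
  assumes "ivp_solution f x0 u"
  shows "solves_on f T u"
  unfolding solves_on_def
proof
  fix t assume "t \<in> {0..T}"
  then have "(u has_vector_derivative f t (u t)) (at t within {0..})"
    using assms by (simp add: ivp_solution_def)
  then show "(u has_vector_derivative f t (u t)) (at t within {0..T})"
    by (rule has_vector_derivative_within_subset) simp
qed

lemma solves_on_norm_squared_deriv:
  fixes u :: "real \<Rightarrow> 'a::real_inner"
  assumes "solves_on f T u" "t \<in> {0..T}"
  shows "((\<lambda>t. (norm (u t))\<^sup>2) has_real_derivative 2 * (u t \<bullet> f t (u t))) (at t within {0..T})"
proof -
  have "(u has_vector_derivative f t (u t)) (at t within {0..T})"
    using assms by (simp add: solves_on_def)
  then have "((\<lambda>t. u t \<bullet> u t) has_vector_derivative u t \<bullet> f t (u t) + f t (u t) \<bullet> u t)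
      (at t within {0..T})"
    by (rule bounded_bilinear.has_vector_derivative[OF bounded_bilinear_inner]) fact
  then show ?thesis
    by (simp add: has_real_derivative_iff_has_vector_derivative power2_norm_eq_inner inner_commute)
qed

text \<open>
  The squared distance \<open>w\<close> of the two solutions satisfies \<open>w' \<le> (2 * L + 1) * w + \<eta>\<^sup>2\<close>: the Lipschitz
  constant controls the change of the argument, and \<open>\<eta>\<close> the change of the field along \<open>v\<close>.
  With equal fields this is uniqueness and continuous dependence on the initial value; with
  different fields it compares the noisy system with the deterministic one.
\<close>

lemma solutions_stay_close:
  fixes u v :: "real \<Rightarrow> 'a::real_inner"
  assumes "0 \<le> T" "0 \<le> L"
    and u: "solves_on f1 T u" "\<And>t. t \<in> {0..T} \<Longrightarrow> u t \<in> B"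
    and v: "solves_on f2 T v" "\<And>t. t \<in> {0..T} \<Longrightarrow> v t \<in> B"
    and lip: "\<And>t x y. t \<in> {0..T} \<Longrightarrow> x \<in> B \<Longrightarrow> y \<in> B \<Longrightarrow>
      norm (f1 t x - f1 t y) \<le> L * norm (x - y)"
    and close: "\<And>t. t \<in> {0..T} \<Longrightarrow> norm (f1 t (v t) - f2 t (v t)) \<le> \<eta>"
  shows "(norm (u T - v T))\<^sup>2 \<le> ((norm (u 0 - v 0))\<^sup>2 + \<eta>\<^sup>2) * exp ((2 * L + 1) * T)"
proof -
  define w where "w t = u t - v t" for t
  define f where "f t x = f1 t (u t) - f2 t (v t)" for t and x :: 'a
  have sol: "solves_on f T w"
    using u(1) v(1) unfolding solves_on_def w_def f_def
    by (auto intro!: has_vector_derivative_diff)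
  have est: "2 * (w t \<bullet> f t (w t)) \<le> (2 * L + 1) * (norm (w t))\<^sup>2 + \<eta>\<^sup>2" if t: "t \<in> {0..T}" for t
  proof -
    have "w t \<bullet> f t (w t) = w t \<bullet> (f1 t (u t) - f1 t (v t)) + w t \<bullet> (f1 t (v t) - f2 t (v t))"
      by (simp add: f_def inner_diff_right)
    also have "\<dots> \<le> norm (w t) * (L * norm (w t)) + norm (w t) * \<eta>"
    proof (rule add_mono)
      show "w t \<bullet> (f1 t (u t) - f1 t (v t)) \<le> norm (w t) * (L * norm (w t))"
        using lip[OF t u(2)[OF t] v(2)[OF t]]
        by (intro order.trans[OF norm_cauchy_schwarz] mult_left_mono) (auto simp: w_def)
      show "w t \<bullet> (f1 t (v t) - f2 t (v t)) \<le> norm (w t) * \<eta>"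
        using close[OF t] by (intro order.trans[OF norm_cauchy_schwarz] mult_left_mono) auto
    qed
    finally have "2 * (w t \<bullet> f t (w t)) \<le> 2 * L * (norm (w t))\<^sup>2 + 2 * norm (w t) * \<eta>"
      by (simp add: power2_eq_square algebra_simps)
    also have "\<dots> \<le> 2 * L * (norm (w t))\<^sup>2 + ((norm (w t))\<^sup>2 + \<eta>\<^sup>2)"
      using sum_squares_bound[of "norm (w t)" \<eta>] by simp
    finally show ?thesis by (simp add: algebra_simps)
  qed
  let ?c = "2 * L + 1"
  have c: "?c \<ge> 1" using \<open>0 \<le> L\<close> by simp
  have "(norm (w T))\<^sup>2 + \<eta>\<^sup>2 / ?c \<le> ((norm (w 0))\<^sup>2 + \<eta>\<^sup>2 / ?c) * exp (?c * T)"
    using c by (intro gronwall[OF \<open>0 \<le> T\<close> _ solves_on_norm_squared_deriv[OF sol] est]) auto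
  moreover have "\<eta>\<^sup>2 / ?c \<ge> 0" using c by simp
  moreover have "((norm (w 0))\<^sup>2 + \<eta>\<^sup>2 / ?c) * exp (?c * T) \<le> ((norm (w 0))\<^sup>2 + \<eta>\<^sup>2) * exp (?c * T)"
  proof -
    have "\<eta>\<^sup>2 / ?c \<le> \<eta>\<^sup>2 / 1" using c by (intro divide_left_mono) auto
    then show ?thesis by (intro mult_right_mono) auto
  qed
  ultimately show ?thesis unfolding w_def by linarith
qed

section \<open>Existence and uniqueness of global solutions\<close>

text \<open>
  Writing the unknown as \<open>u t = exp (2 * L * t) *\<^sub>R v t\<close> turns the sup norm of \<open>v\<close> into a weighted norm of \<open>u\<close>
  in which the integral operator contracts by \<open>1/2\<close> on the whole of \<open>{0..T}\<close>, whatever \<open>T\<close> is, so that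
  no gluing of short-time solutions is needed.
\<close>

lemma picard_lindelof_lipschitz:
  fixes h :: "real \<Rightarrow> 'a \<Rightarrow> 'a::banach"
  assumes "0 \<le> T" "0 < L"
    and cont: "continuous_on ({0..T} \<times> UNIV) (\<lambda>(t, x). h t x)"
    and lip: "\<And>t x y. t \<in> {0..T} \<Longrightarrow> norm (h t x - h t y) \<le> L * norm (x - y)"
  shows "\<exists>u. u 0 = x0 \<and> solves_on h T u"
proof -
  \<comment> \<open>bounded continuous functions live on the whole line, so time is clamped to \<open>{0..T}\<close>\<close>
  define cl where "cl t = max 0 (min T t)" for t :: real
  have cl: "cl t \<in> {0..T}" for t using \<open>0 \<le> T\<close> by (auto simp: cl_def)
  have cl_id: "cl t = t" if "t \<in> {0..T}" for t using that by (auto simp: cl_def)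
  have cl_cont: "continuous_on UNIV cl" unfolding cl_def by (intro continuous_intros)
  define rhs where "rhs v r = h r (exp (2 * L * r) *\<^sub>R apply_bcontfun v r)" for v and r :: real
  define J where "J v t = exp (- 2 * L * t) *\<^sub>R (x0 + integral {0..t} (rhs v))" for v t
  have rhs_cont: "continuous_on {0..T} (rhs v)" for v
    unfolding rhs_def
    by (rule continuous_on_compose2[OF cont, of _ "\<lambda>r. (r, _ r)", simplified])
       (auto intro!: continuous_intros)
  have int_deriv: "((\<lambda>t. integral {0..t} (rhs v)) has_vector_derivative rhs v t) (at t within {0..T})"
    if "t \<in> {0..T}" for v t
    using integral_has_vector_derivative[OF rhs_cont that] .
  have rhs_int: "rhs v integrable_on {0..t}" if "t \<in> {0..T}" for v t
    using that by (intro integrable_continuous_real continuous_on_subset[OF rhs_cont]) auto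
  have J_cont: "continuous_on {0..T} (J v)" for v
    unfolding J_def
    by (intro continuous_intros continuous_on_vector_derivative[OF int_deriv])
  have J_bcont: "(\<lambda>t. J v (cl t)) \<in> bcontfun" for v
  proof -
    have "continuous_on UNIV (\<lambda>t. J v (cl t))"
      using cl by (intro continuous_on_compose2[OF J_cont cl_cont]) auto
    moreover have "bounded (range (\<lambda>t. J v (cl t)))"
      by (rule bounded_subset[OF compact_imp_bounded[OF compact_continuous_image[OF J_cont]]])
         (use cl in auto)
    ultimately show ?thesis by (auto simp: bcontfun_def)
  qed
  define \<Phi> where "\<Phi> v = Bcontfun (\<lambda>t. J v (cl t))" for v
  have \<Phi>: "apply_bcontfun (\<Phi> v) t = J v (cl t)" for v t
    unfolding \<Phi>_def using J_bcont by (simp add: Bcontfun_inverse)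
  have "dist (\<Phi> v) (\<Phi> w) \<le> 1/2 * dist v w" for v w
  proof (rule dist_bound)
    fix t
    define s where "s = cl t"
    have s: "s \<in> {0..T}" using cl by (simp add: s_def)
    have e: "((\<lambda>r. L * exp (2 * L * r) * dist v w) has_integral
        exp (2 * L * s) / 2 * dist v w - exp (2 * L * 0) / 2 * dist v w) {0..s}"
      using s \<open>0 < L\<close>
      by (intro fundamental_theorem_of_calculus)
         (auto intro!: derivative_eq_intros simp: simp flip: has_real_derivative_iff_has_vector_derivative)
    have "norm (integral {0..s} (\<lambda>r. rhs v r - rhs w r)) \<le>
        integral {0..s} (\<lambda>r. L * exp (2 * L * r) * dist v w)"
    proof (rule integral_norm_bound_integral)
      show "(\<lambda>r. rhs v r - rhs w r) integrable_on {0..s}"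
        using rhs_int[OF s] by (intro integrable_diff)
      show "(\<lambda>r. L * exp (2 * L * r) * dist v w) integrable_on {0..s}"
        using e by blast
      fix r assume "r \<in> {0..s}"
      then have r: "r \<in> {0..T}" using s by auto
      have "norm (rhs v r - rhs w r) \<le>
          L * norm (exp (2 * L * r) *\<^sub>R apply_bcontfun v r - exp (2 * L * r) *\<^sub>R apply_bcontfun w r)"
        unfolding rhs_def by (rule lip[OF r])
      also have "\<dots> = L * exp (2 * L * r) * dist (apply_bcontfun v r) (apply_bcontfun w r)"
        by (simp add: dist_norm flip: scaleR_diff_right)
      also have "\<dots> \<le> L * exp (2 * L * r) * dist v w"
        using \<open>0 < L\<close> by (intro mult_left_mono dist_bounded) auto
      finally show "norm (rhs v r - rhs w r) \<le> L * exp (2 * L * r) * dist v w" .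
    qed
    also have "\<dots> = (exp (2 * L * s) - 1) / 2 * dist v w"
      using integral_unique[OF e] by (simp add: algebra_simps diff_divide_distrib)
    also have "\<dots> \<le> exp (2 * L * s) / 2 * dist v w"
      by (intro mult_right_mono) auto
    finally have i: "norm (integral {0..s} (rhs v) - integral {0..s} (rhs w)) \<le>
        exp (2 * L * s) / 2 * dist v w"
      using rhs_int[OF s] by (simp add: integral_diff)
    have "dist (apply_bcontfun (\<Phi> v) t) (apply_bcontfun (\<Phi> w) t) =
        exp (- 2 * L * s) * norm (integral {0..s} (rhs v) - integral {0..s} (rhs w))"
      by (simp add: \<Phi> J_def s_def dist_norm flip: scaleR_diff_right)
    also have "\<dots> \<le> exp (- 2 * L * s) * (exp (2 * L * s) / 2 * dist v w)"
      by (intro mult_left_mono i) auto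
    also have "\<dots> = 1/2 * dist v w"
      by (simp add: exp_minus)
    finally show "dist (apply_bcontfun (\<Phi> v) t) (apply_bcontfun (\<Phi> w) t) \<le> 1/2 * dist v w" .
  qed
  then have "\<exists>!v. \<Phi> v = v"
    by (intro banach_fix_type[of "1/2"]) auto
  then obtain v where v: "\<Phi> v = v" by blast
  define u where "u t = x0 + integral {0..t} (rhs v)" for t
  have fixpt: "exp (2 * L * t) *\<^sub>R apply_bcontfun v t = u t" if "t \<in> {0..T}" for t
    using \<Phi>[of v t] v cl_id[OF that] by (simp add: J_def u_def flip: exp_add)
  have "solves_on h T u"
    unfolding solves_on_def
  proof
    fix t assume t: "t \<in> {0..T}"
    have "(u has_vector_derivative 0 + rhs v t) (at t within {0..T})"
      unfolding u_def by (intro derivative_intros int_deriv t)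
    then show "(u has_vector_derivative h t (u t)) (at t within {0..T})"
      by (simp add: rhs_def fixpt[OF t])
  qed
  moreover have "u 0 = x0" by (simp add: u_def)
  ultimately show ?thesis by blast
qed

text \<open>
  Multiplying by a bump function that vanishes outside the ball of radius \<open>R + 1\<close> makes a locally
  Lipschitz map globally Lipschitz. When one of the points lies outside, the difference of the
  cutoff factors alone gives the estimate.
\<close>

lemma lipschitz_cutoff:
  fixes h :: "'a::real_normed_vector \<Rightarrow> 'b::real_normed_vector" and \<phi> :: "'a \<Rightarrow> real"
  assumes \<phi>: "\<And>x. \<phi> x = max 0 (min 1 (R + 1 - norm x))"
    and "0 \<le> L" "0 \<le> M"
    and lip: "\<And>x y. x \<in> cball 0 (R + 1) \<Longrightarrow> y \<in> cball 0 (R + 1) \<Longrightarrow>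
      norm (h x - h y) \<le> L * norm (x - y)"
    and bound: "\<And>x. x \<in> cball 0 (R + 1) \<Longrightarrow> norm (h x) \<le> M"
  shows "norm (\<phi> x *\<^sub>R h x - \<phi> y *\<^sub>R h y) \<le> (L + M) * norm (x - y)"
proof -
  have \<phi>_lip: "\<bar>\<phi> x - \<phi> y\<bar> \<le> norm (x - y)" for x y
    using norm_triangle_ineq3[of x y] unfolding \<phi> by linarith
  have \<phi>_bound: "\<bar>\<phi> x\<bar> \<le> 1" for x unfolding \<phi> by linarith
  have \<phi>_zero: "\<phi> x = 0" if "x \<notin> cball 0 (R + 1)" for x
    using that by (simp add: \<phi>)
  have outside: "norm (\<phi> x *\<^sub>R h x) \<le> (L + M) * norm (x - y)"
    if "y \<notin> cball 0 (R + 1)" for x y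
  proof (cases "x \<in> cball 0 (R + 1)")
    case True
    have "norm (\<phi> x *\<^sub>R h x) = \<bar>\<phi> x - \<phi> y\<bar> * norm (h x)"
      using \<phi>_zero[OF that] by simp
    also have "\<dots> \<le> norm (x - y) * M"
      using \<phi>_lip bound[OF True] by (intro mult_mono) auto
    also have "\<dots> \<le> (L + M) * norm (x - y)"
      using \<open>0 \<le> L\<close> by (simp add: algebra_simps)
    finally show ?thesis .
  next
    case False
    then show ?thesis using \<phi>_zero[of x] assms by simp
  qed
  show ?thesis
  proof (cases "x \<in> cball 0 (R + 1) \<and> y \<in> cball 0 (R + 1)")
    case True
    have "\<phi> x *\<^sub>R h x - \<phi> y *\<^sub>R h y = \<phi> x *\<^sub>R (h x - h y) + (\<phi> x - \<phi> y) *\<^sub>R h y"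
      by (simp add: algebra_simps)
    also have "norm \<dots> \<le> \<bar>\<phi> x\<bar> * norm (h x - h y) + \<bar>\<phi> x - \<phi> y\<bar> * norm (h y)"
      by (rule order.trans[OF norm_triangle_ineq]) simp
    also have "\<dots> \<le> 1 * (L * norm (x - y)) + norm (x - y) * M"
      using True by (intro add_mono mult_mono \<phi>_bound \<phi>_lip lip bound) auto
    finally show ?thesis by (simp add: algebra_simps)
  next
    case False
    then show ?thesis
      using outside[of y x] outside[of x y] \<phi>_zero[of x] \<phi>_zero[of y]
      by (auto simp: norm_minus_commute)
  qed
qed

text \<open>
  The one-sided growth condition excludes blow-up in forward time only, which suffices because
  all solutions here start at time 0.
\<close>

locale dissipative_field =
  fixes f :: "real \<Rightarrow> 'a::euclidean_space \<Rightarrow> 'a"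
  assumes field_continuous: "continuous_on ({0..} \<times> UNIV) (\<lambda>(t, x). f t x)"
    and lipschitz_on_balls: "\<exists>L. \<forall>t\<in>{0..T}. \<forall>x\<in>cball 0 R. \<forall>y\<in>cball 0 R.
      norm (f t x - f t y) \<le> L * norm (x - y)"
    and growth: "\<exists>C. \<forall>t\<in>{0..T}. \<forall>x. x \<bullet> f t x \<le> C * (1 + (norm x)\<^sup>2)"
begin

lemma obtain_lipschitz:
  obtains L where "0 \<le> L" "\<And>t x y. t \<in> {0..T} \<Longrightarrow> x \<in> cball 0 R \<Longrightarrow> y \<in> cball 0 R \<Longrightarrow>
      norm (f t x - f t y) \<le> L * norm (x - y)"
proof -
  from lipschitz_on_balls[of T R] obtain L where
    L: "\<forall>t\<in>{0..T}. \<forall>x\<in>cball 0 R. \<forall>y\<in>cball 0 R. norm (f t x - f t y) \<le> L * norm (x - y)"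
    by blast
  have "norm (f t x - f t y) \<le> \<bar>L\<bar> * norm (x - y)"
    if "t \<in> {0..T}" "x \<in> cball 0 R" "y \<in> cball 0 R" for t x y
  proof -
    have "norm (f t x - f t y) \<le> L * norm (x - y)" using L that by blast
    also have "\<dots> \<le> \<bar>L\<bar> * norm (x - y)" by (intro mult_right_mono) auto
    finally show ?thesis .
  qed
  then show ?thesis by (intro that[of "\<bar>L\<bar>"]) auto
qed

lemma obtain_growth:
  obtains C where "0 < C" "\<And>t x. t \<in> {0..T} \<Longrightarrow> x \<bullet> f t x \<le> C * (1 + (norm x)\<^sup>2)"
proof -
  from growth[of T] obtain C where C: "\<forall>t\<in>{0..T}. \<forall>x. x \<bullet> f t x \<le> C * (1 + (norm x)\<^sup>2)"
    by blast
  have "x \<bullet> f t x \<le> (\<bar>C\<bar> + 1) * (1 + (norm x)\<^sup>2)" if "t \<in> {0..T}" for t x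
  proof -
    have "x \<bullet> f t x \<le> C * (1 + (norm x)\<^sup>2)" using C that by blast
    also have "\<dots> \<le> (\<bar>C\<bar> + 1) * (1 + (norm x)\<^sup>2)" by (intro mult_right_mono) auto
    finally show ?thesis .
  qed
  then show ?thesis by (intro that[of "\<bar>C\<bar> + 1"]) auto
qed

end

lemma growth_bound:
  fixes u :: "real \<Rightarrow> 'a::real_inner"
  assumes "0 < C" and u: "solves_on h T u" and t: "t \<in> {0..T}"
    and C: "\<And>s x. s \<in> {0..T} \<Longrightarrow> x \<bullet> h s x \<le> C * (1 + (norm x)\<^sup>2)"
  shows "norm (u t) \<le> ((norm (u 0))\<^sup>2 + 1) * exp (2 * C * T)"
proof -
  have ut: "solves_on h t u" using solves_on_subinterval[OF u] t by simp
  have le: "2 * (u s \<bullet> h s (u s)) \<le> 2 * C * (norm (u s))\<^sup>2 + 2 * C" if "s \<in> {0..t}" for s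
    using C[of s "u s"] that t by (simp add: algebra_simps)
  have "(norm (u t))\<^sup>2 + 2 * C / (2 * C) \<le> ((norm (u 0))\<^sup>2 + 2 * C / (2 * C)) * exp (2 * C * t)"
    using t \<open>0 < C\<close>
    by (intro gronwall[OF _ _ solves_on_norm_squared_deriv[OF ut] le]) auto
  then have "(norm (u t))\<^sup>2 + 1 \<le> ((norm (u 0))\<^sup>2 + 1) * exp (2 * C * t)"
    using \<open>0 < C\<close> by simp
  also have "\<dots> \<le> ((norm (u 0))\<^sup>2 + 1) * exp (2 * C * T)"
    using t \<open>0 < C\<close> by (intro mult_left_mono) auto
  finally have "(norm (u t))\<^sup>2 + 1 \<le> ((norm (u 0))\<^sup>2 + 1) * exp (2 * C * T)" .
  moreover have "norm (u t) \<le> (norm (u t))\<^sup>2 + 1"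
    using sum_squares_bound[of "norm (u t)" 1] by simp (smt (verit) norm_ge_zero)
  ultimately show ?thesis by linarith
qed

context dissipative_field
begin

text \<open>
  The cutoff multiplies \<open>f t x\<close> by a factor between 0 and 1, so it preserves the one-sided growth
  condition with the same constant. The a priori bound \<open>R\<close> therefore holds already for the solution
  of the truncated equation, which never leaves the ball on which nothing was changed.
\<close>

lemma exists_solution_on_interval:
  assumes "0 \<le> T"
  shows "\<exists>u. u 0 = x0 \<and> solves_on f T u"
proof -
  obtain C where C: "0 < C" "\<And>t x. t \<in> {0..T} \<Longrightarrow> x \<bullet> f t x \<le> C * (1 + (norm x)\<^sup>2)"
    using obtain_growth by metis
  define R where "R = ((norm x0)\<^sup>2 + 1) * exp (2 * C * T)"
  obtain L where L: "0 \<le> L" "\<And>t x y. t \<in> {0..T} \<Longrightarrow> x \<in> cball 0 (R + 1) \<Longrightarrow>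
      y \<in> cball 0 (R + 1) \<Longrightarrow> norm (f t x - f t y) \<le> L * norm (x - y)"
    using obtain_lipschitz by metis
  have "compact ((\<lambda>(t, x). f t x) ` ({0..T} \<times> cball 0 (R + 1)))"
    by (intro compact_continuous_image continuous_on_subset[OF field_continuous] compact_Times) auto
  then obtain M where M: "M > 0" "\<And>t x. t \<in> {0..T} \<Longrightarrow> x \<in> cball 0 (R + 1) \<Longrightarrow> norm (f t x) \<le> M"
    using compact_imp_bounded bounded_pos by (smt (verit) SigmaI bounded_pos case_prod_conv imageI)
  define \<phi> where "\<phi> x = max 0 (min 1 (R + 1 - norm x))" for x :: 'a
  define h where "h t x = \<phi> x *\<^sub>R f t x" for t x
  have "\<exists>u. u 0 = x0 \<and> solves_on h T u"
  proof (rule picard_lindelof_lipschitz[OF \<open>0 \<le> T\<close>, of "L + M"])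
    show "0 < L + M" using L M by simp
    show "norm (h t x - h t y) \<le> (L + M) * norm (x - y)" if "t \<in> {0..T}" for t x y
      unfolding h_def using L M that by (intro lipschitz_cutoff[OF \<phi>_def]) auto
    have "continuous_on ({0..T} \<times> UNIV) (\<lambda>z. \<phi> (snd z) *\<^sub>R (\<lambda>(t, x). f t x) z)"
      unfolding \<phi>_def
      by (intro continuous_intros continuous_on_subset[OF field_continuous]) auto
    then show "continuous_on ({0..T} \<times> UNIV) (\<lambda>(t, x). h t x)"
      by (simp add: h_def case_prod_unfold)
  qed
  then obtain u where u: "u 0 = x0" "solves_on h T u" by blast
  have h_growth: "x \<bullet> h t x \<le> C * (1 + (norm x)\<^sup>2)" if t: "t \<in> {0..T}" for t x
  proof -
    have \<phi>: "0 \<le> \<phi> x" "\<phi> x \<le> 1" unfolding \<phi>_def by linarith+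
    have "x \<bullet> h t x = \<phi> x * (x \<bullet> f t x)" by (simp add: h_def)
    also have "\<dots> \<le> \<phi> x * (C * (1 + (norm x)\<^sup>2))" using C(2)[OF t] \<phi> by (intro mult_left_mono)
    also have "\<dots> \<le> 1 * (C * (1 + (norm x)\<^sup>2))" using C(1) \<phi> by (intro mult_right_mono) auto
    finally show ?thesis by simp
  qed
  have "h t (u t) = f t (u t)" if t: "t \<in> {0..T}" for t
  proof -
    have "norm (u t) \<le> R"
      using growth_bound[OF C(1) u(2) t h_growth] by (simp add: R_def u(1))
    then show ?thesis by (simp add: h_def \<phi>_def)
  qed
  then have "solves_on f T u" using u(2) unfolding solves_on_def by auto
  with u(1) show ?thesis by blast
qed

lemma solutions_agree:
  assumes "0 \<le> T" and u: "solves_on f T u" and v: "solves_on f T v" and "u 0 = v 0"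
  shows "u T = v T"
proof -
  obtain C where C: "0 < C" "\<And>t x. t \<in> {0..T} \<Longrightarrow> x \<bullet> f t x \<le> C * (1 + (norm x)\<^sup>2)"
    using obtain_growth by metis
  define R where "R = ((norm (u 0))\<^sup>2 + 1) * exp (2 * C * T)"
  obtain L where L: "0 \<le> L" "\<And>t x y. t \<in> {0..T} \<Longrightarrow> x \<in> cball 0 R \<Longrightarrow>
      y \<in> cball 0 R \<Longrightarrow> norm (f t x - f t y) \<le> L * norm (x - y)"
    using obtain_lipschitz by metis
  have uR: "u t \<in> cball 0 R" and vR: "v t \<in> cball 0 R" if "t \<in> {0..T}" for t
    using growth_bound[OF C(1) u that C(2)] growth_bound[OF C(1) v that C(2)] \<open>u 0 = v 0\<close>
    by (auto simp: R_def)
  have "(norm (u T - v T))\<^sup>2 \<le> ((norm (u 0 - v 0))\<^sup>2 + 0\<^sup>2) * exp ((2 * L + 1) * T)"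
    by (rule solutions_stay_close[OF \<open>0 \<le> T\<close> L(1) u uR v vR L(2)]) auto
  then show ?thesis by (simp add: \<open>u 0 = v 0\<close>)
qed

lemma exists_ivp_solution: "\<exists>u. ivp_solution f x0 u"
proof -
  have "\<forall>n. \<exists>u. u 0 = x0 \<and> solves_on f (real n) u"
    using exists_solution_on_interval by simp
  then obtain U where U: "\<And>n. U n 0 = x0" "\<And>n. solves_on f (real n) (U n)" by metis
  \<comment> \<open>any interval \<open>{0..n}\<close> that contains \<open>t\<close> in its interior gives the same value\<close>
  define u where "u t = U (nat \<lceil>t\<rceil> + 1) t" for t
  have u_eq: "u t = U n t" if "0 \<le> t" "t \<le> real n" for t n
    unfolding u_def
  proof (rule solutions_agree[of t "U (nat \<lceil>t\<rceil> + 1)" "U n"])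
    have "t \<le> real (nat \<lceil>t\<rceil> + 1)" by linarith
    then show "solves_on f t (U (nat \<lceil>t\<rceil> + 1))" by (rule solves_on_subinterval[OF U(2)])
    show "solves_on f t (U n)" using U(2) that(2) by (rule solves_on_subinterval)
  qed (use that U in auto)
  have "(u has_vector_derivative f t (u t)) (at t within {0..})" if "0 \<le> t" for t
  proof -
    define n where "n = nat \<lceil>t\<rceil> + 1"
    have tn: "t < real n" unfolding n_def by linarith
    have "(U n has_vector_derivative f t (U n t)) (at t within {0..real n})"
      using U(2)[of n] tn that by (simp add: solves_on_def)
    also have "at t within {0..real n} = at t within {0..}"
      using tn by (intro at_within_nhd[of _ "{..<real n}"]) auto
    finally have "(U n has_vector_derivative f t (u t)) (at t within {0..})"
      using u_eq[of t n] tn that by simp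
    then show ?thesis
      by (rule has_vector_derivative_transform_within[where d = "real n - t"])
         (use tn that in \<open>auto intro!: u_eq[symmetric] simp: dist_real_def\<close>)
  qed
  moreover have "u 0 = x0" by (simp add: u_def U)
  ultimately show ?thesis unfolding ivp_solution_def by blast
qed

lemma solution_op_eq:
  assumes "ivp_solution f x0 u" "0 \<le> t"
  shows "solution_op f t x0 = u t"
  unfolding solution_op_def
proof (rule the_equality)
  show "\<exists>v. ivp_solution f x0 v \<and> v t = u t" using assms by blast
  fix x assume "\<exists>v. ivp_solution f x0 v \<and> v t = x"
  then obtain v where v: "ivp_solution f x0 v" "v t = x" by blast
  have "v t = u t"
    by (rule solutions_agree[OF \<open>0 \<le> t\<close>])
       (use v assms in \<open>auto intro: ivp_solution_solves_on simp: ivp_solution_def\<close>)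
  with v show "x = u t" by simp
qed

end

lemma solution_op_semigroup:
  assumes "dissipative_field (\<lambda>_. F)" and "0 \<le> s" "0 \<le> t"
  shows "solution_op (\<lambda>_. F) (s + t) x = solution_op (\<lambda>_. F) s (solution_op (\<lambda>_. F) t x)"
proof -
  interpret dissipative_field "\<lambda>_. F" by fact
  obtain u where u: "ivp_solution (\<lambda>_. F) x u" using exists_ivp_solution by blast
  have "ivp_solution (\<lambda>_. F) (u t) (\<lambda>r. u (r + t))"
    unfolding ivp_solution_def
  proof (intro conjI allI impI)
    fix r :: real assume r: "0 \<le> r"
    have "(u has_vector_derivative F (u (r + t))) (at (r + t) within {0..})"
      using u r \<open>0 \<le> t\<close> by (simp add: ivp_solution_def)
    then have "(u has_vector_derivative F (u (r + t))) (at (r + t) within (\<lambda>r. r + t) ` {0..})"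
      by (rule has_vector_derivative_within_subset) (use \<open>0 \<le> t\<close> in auto)
    then have "(u \<circ> (\<lambda>r. r + t) has_vector_derivative 1 *\<^sub>R F (u (r + t))) (at r within {0..})"
      by (intro vector_diff_chain_within) (auto intro!: derivative_eq_intros)
    then show "((\<lambda>r. u (r + t)) has_vector_derivative F (u (r + t))) (at r within {0..})"
      by (simp add: o_def)
  qed simp
  then show ?thesis
    using solution_op_eq u assms by simp
qed

section \<open>Attractors of semigroups with a compact absorbing set\<close>

lemma semidist_tendsto_0_iff:
  "((\<lambda>t. semidist (A t) B) \<longlongrightarrow> 0) F \<longleftrightarrow>
     (\<forall>e>0. \<forall>\<^sub>F t in F. \<forall>a\<in>A t. \<exists>b\<in>B. norm (a - b) < e)"
proof (intro iffI allI impI)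
  fix e :: real
  assume lim: "((\<lambda>t. semidist (A t) B) \<longlongrightarrow> 0) F" and "e > 0"
  then have "\<forall>\<^sub>F t in F. semidist (A t) B < ennreal e"
    by (intro order_tendstoD(2)[OF lim]) simp
  then show "\<forall>\<^sub>F t in F. \<forall>a\<in>A t. \<exists>b\<in>B. norm (a - b) < e"
  proof eventually_elim
    case (elim t)
    show ?case
    proof
      fix a assume "a \<in> A t"
      then have "(INF b\<in>B. ennreal (norm (a - b))) < ennreal e"
        using elim unfolding semidist_def by (rule_tac le_less_trans[OF SUP_upper])
      then show "\<exists>b\<in>B. norm (a - b) < e"
        by (auto simp: INF_less_iff ennreal_less_iff)
    qed
  qed
next
  assume ev: "\<forall>e>0. \<forall>\<^sub>F t in F. \<forall>a\<in>A t. \<exists>b\<in>B. norm (a - b) < e"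
  show "((\<lambda>t. semidist (A t) B) \<longlongrightarrow> 0) F"
  proof (rule order_tendstoI)
    fix y :: ennreal assume "0 < y"
    then obtain z where z: "0 < z" "z < y" using dense by blast
    then obtain e where e: "z = ennreal e" "e > 0"
      by (cases z) (auto simp: less_top[symmetric] top_unique)
    from ev e(2) have "\<forall>\<^sub>F t in F. \<forall>a\<in>A t. \<exists>b\<in>B. norm (a - b) < e" by blast
    then show "\<forall>\<^sub>F t in F. semidist (A t) B < y"
    proof eventually_elim
      case (elim t)
      have "semidist (A t) B \<le> ennreal e"
        unfolding semidist_def
      proof (rule SUP_least)
        fix a assume "a \<in> A t"
        with elim obtain b where "b \<in> B" "norm (a - b) < e" by blast
        then show "(INF b\<in>B. ennreal (norm (a - b))) \<le> ennreal e"
          by (intro INF_lower2[of b]) (auto intro: ennreal_leI)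
      qed
      with z e show ?case by simp
    qed
  qed simp
qed

text \<open>
  The images of the positively invariant compact set \<open>B\<close> decrease in time, and the attractor is their
  intersection. Nested compactness is used twice: the sets of preimages of a point of the
  intersection are nested, which gives negative invariance, and the parts of the images outside a
  neighbourhood of the intersection are nested with empty intersection, which gives attraction.
\<close>

lemma semigroup_global_attractor:
  fixes S :: "real \<Rightarrow> 'a::euclidean_space \<Rightarrow> 'a"
  assumes B: "compact B" "B \<noteq> {}"
    and invariant: "\<And>t. 0 \<le> t \<Longrightarrow> S t ` B \<subseteq> B"
    and cont: "\<And>t. 0 \<le> t \<Longrightarrow> continuous_on B (S t)"
    and semigroup: "\<And>s t x. 0 \<le> s \<Longrightarrow> 0 \<le> t \<Longrightarrow> S (s + t) x = S s (S t x)"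
    and absorbing: "\<And>D. bounded D \<Longrightarrow> \<exists>T\<ge>0. S T ` D \<subseteq> B"
  shows "global_attractor S (\<Inter>n. S (real n) ` B)"
proof -
  define A where "A = (\<Inter>n. S (real n) ` B)"
  have compact: "compact (S t ` B)" if "0 \<le> t" for t
    using compact_continuous_image[OF cont B(1)] that .
  have anti: "S t ` B \<subseteq> S s ` B" if "0 \<le> s" "s \<le> t" for s t
  proof -
    have "S t ` B = S s ` S (t - s) ` B"
      using semigroup[of s "t - s"] that by (auto simp: image_image)
    then show ?thesis using invariant[of "t - s"] that by auto
  qed
  have A_sub: "A \<subseteq> S t ` B" if "0 \<le> t" for t
  proof -
    obtain n where "t \<le> real n" using real_arch_simple by blast
    then show ?thesis using anti[OF that] by (force simp: A_def)
  qed
  have A_sub_B: "A \<subseteq> B" using A_sub[of 0] invariant[of 0] by auto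
  have compact_A: "compact A"
    unfolding A_def by (intro compact_Inter) (auto intro: compact)
  have "S t ` A = A" if t: "0 \<le> t" for t
  proof
    show "S t ` A \<subseteq> A"
    proof (unfold A_def, rule INT_greatest)
      fix n
      have "S t ` A \<subseteq> S t ` S (real n) ` B" using A_sub[of "real n"] by auto
      also have "\<dots> = S (real n + t) ` B"
        using semigroup[of t "real n"] t by (auto simp: image_image add.commute)
      also have "\<dots> \<subseteq> S (real n) ` B" using t by (intro anti) auto
      finally show "S t ` (\<Inter>n. S (real n) ` B) \<subseteq> S (real n) ` B" by (simp add: A_def)
    qed
    show "A \<subseteq> S t ` A"
    proof
      fix y assume "y \<in> A"
      define K where "K n = {x \<in> S (real n) ` B. S t x = y}" for n
      have "\<Inter>(range K) \<noteq> {}"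
      proof (rule compact_nest)
        fix n
        have sub: "S (real n) ` B \<subseteq> B" by (rule invariant) simp
        have "closedin (top_of_set (S (real n) ` B)) (S (real n) ` B \<inter> S t -` {y})"
          by (intro continuous_closedin_preimage continuous_on_subset[OF cont[OF t] sub]) auto
        moreover have "K n = S (real n) ` B \<inter> S t -` {y}" by (auto simp: K_def)
        ultimately show "compact (K n)"
          using compact[of "real n"] closedin_compact by force
        have "y \<in> S (t + real n) ` B" using \<open>y \<in> A\<close> A_sub[of "t + real n"] t by auto
        then show "K n \<noteq> {}" using semigroup[of t "real n"] t by (auto simp: K_def)
      next
        fix m n :: nat assume "m \<le> n"
        then show "K n \<subseteq> K m" using anti[of "real m" "real n"] by (auto simp: K_def)
      qed
      then show "y \<in> S t ` A" by (auto simp: K_def A_def)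
    qed
  qed
  moreover have "((\<lambda>t. semidist (S t ` D) A) \<longlongrightarrow> 0) at_top" if D: "bounded D" for D
    unfolding semidist_tendsto_0_iff
  proof (intro allI impI)
    fix e :: real assume "e > 0"
    define U where "U = (\<Union>b\<in>A. ball b e)"
    have "\<exists>n. S (real n) ` B \<subseteq> U"
    proof (rule ccontr)
      assume no: "\<nexists>n. S (real n) ` B \<subseteq> U"
      have "\<Inter>(range (\<lambda>n. S (real n) ` B - U)) \<noteq> {}"
      proof (rule compact_nest)
        show "compact (S (real n) ` B - U)" for n
          by (intro compact_diff compact) (auto simp: U_def)
        show "S (real n) ` B - U \<noteq> {}" for n using no by auto
        show "S (real n) ` B - U \<subseteq> S (real m) ` B - U" if "m \<le> n" for m n
          using anti[of "real m" "real n"] that by auto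
      qed
      then obtain x where "x \<in> A" "x \<notin> U" by (auto simp: A_def)
      then show False using \<open>e > 0\<close> by (auto simp: U_def)
    qed
    then obtain n where n: "S (real n) ` B \<subseteq> U" by blast
    obtain T where T: "T \<ge> 0" "S T ` D \<subseteq> B" using absorbing[OF D] by blast
    have "\<forall>\<^sub>F t in at_top. t \<ge> T + real n" by (rule eventually_ge_at_top)
    then show "\<forall>\<^sub>F t in at_top. \<forall>a\<in>S t ` D. \<exists>b\<in>A. norm (a - b) < e"
    proof eventually_elim
      case (elim t)
      have "S t ` D = S (t - T) ` S T ` D"
        using semigroup[of "t - T" T] elim T(1) by (auto simp: image_image)
      also have "\<dots> \<subseteq> S (real n) ` B"
        using T(2) anti[of "real n" "t - T"] elim by fastforce
      finally show ?case using n by (fastforce simp: U_def dist_norm norm_minus_commute)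
    qed
  qed
  ultimately show ?thesis
    unfolding global_attractor_def A_def[symmetric] using compact_A by blast
qed

section \<open>The vector field of the truncated lattice\<close>

lemma powr_increment_le:
  fixes a b p :: real
  assumes "0 < p" "0 \<le> b" "b \<le> a"
  shows "a powr (p + 1) - b powr (p + 1) \<le> (p + 1) * a powr p * (a - b)"
proof (cases "b = a")
  case False
  then have "b < a" using assms by simp
  have "\<exists>l z. b < z \<and> z < a \<and> ((\<lambda>s. s powr (p + 1)) has_real_derivative l) (at z) \<and>
      a powr (p + 1) - b powr (p + 1) = (a - b) * l"
  proof (rule MVT[OF \<open>b < a\<close>])
    show "continuous_on {b..a} (\<lambda>s. s powr (p + 1))"
      using assms by (intro continuous_on_powr') (auto intro!: continuous_intros)
    show "(\<lambda>s. s powr (p + 1)) differentiable (at s)" if "b < s" for s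
      using has_real_derivative_powr[of s "p + 1"] that assms by (auto simp: real_differentiable_def)
  qed
  then obtain l z where z: "b < z" "z < a" "((\<lambda>s. s powr (p + 1)) has_real_derivative l) (at z)"
    "a powr (p + 1) - b powr (p + 1) = (a - b) * l" by blast
  have "l = (p + 1) * z powr p"
    using DERIV_unique[OF z(3) has_real_derivative_powr] z(1) assms by simp
  also have "\<dots> \<le> (p + 1) * a powr p"
    using z assms by (intro mult_left_mono powr_mono2) auto
  finally have "(a - b) * l \<le> (a - b) * ((p + 1) * a powr p)"
    using assms by (intro mult_left_mono) auto
  then show ?thesis using z(4) by (simp add: mult.commute)
qed simp

text \<open>
  If \<open>y\<close> is the shorter vector, the change of the factor is weighted by \<open>norm y\<close>, and
  \<open>(norm x powr p - norm y powr p) * norm y\<close> is at most the increment of the power \<open>p + 1\<close>.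
  The latter is differentiable with bounded derivative near 0 for all \<open>p > 0\<close>, which fails for the
  power \<open>p\<close> itself if \<open>p < 1\<close>.
\<close>

lemma norm_powr_lipschitz:
  fixes x y :: "'a::real_normed_vector"
  assumes "0 < p" "norm x \<le> R" "norm y \<le> R"
  shows "norm (norm x powr p *\<^sub>R x - norm y powr p *\<^sub>R y) \<le> (p + 2) * R powr p * norm (x - y)"
proof -
  have ordered: "norm (norm x powr p *\<^sub>R x - norm y powr p *\<^sub>R y) \<le> (p + 2) * R powr p * norm (x - y)"
    if "norm y \<le> norm x" "norm x \<le> R" for x y :: 'a
  proof -
    have R: "norm x powr p \<le> R powr p" using that \<open>0 < p\<close> by (intro powr_mono2) auto
    have mono: "norm y powr p \<le> norm x powr p" using that \<open>0 < p\<close> by (intro powr_mono2) auto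
    have "(norm x powr p - norm y powr p) * norm y \<le> norm x powr (p + 1) - norm y powr (p + 1)"
      using that \<open>0 < p\<close> by (auto simp: powr_add left_diff_distrib intro!: mult_left_mono)
    also have "\<dots> \<le> (p + 1) * norm x powr p * (norm x - norm y)"
      using that \<open>0 < p\<close> by (intro powr_increment_le) auto
    also have "\<dots> \<le> (p + 1) * R powr p * norm (x - y)"
      using that \<open>0 < p\<close> R by (intro mult_mono norm_triangle_ineq2) auto
    finally have y: "(norm x powr p - norm y powr p) * norm y \<le> (p + 1) * R powr p * norm (x - y)" .
    have "norm x powr p *\<^sub>R x - norm y powr p *\<^sub>R y =
        norm x powr p *\<^sub>R (x - y) + (norm x powr p - norm y powr p) *\<^sub>R y"
      by (simp add: algebra_simps)
    also have "norm \<dots> \<le> norm x powr p * norm (x - y) + (norm x powr p - norm y powr p) * norm y"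
      using mono by (intro order.trans[OF norm_triangle_ineq]) simp
    also have "\<dots> \<le> R powr p * norm (x - y) + (p + 1) * R powr p * norm (x - y)"
      using y R by (intro add_mono mult_right_mono) auto
    finally show ?thesis by (simp add: algebra_simps)
  qed
  show ?thesis
    using ordered[of x y] ordered[of y x] assms linear[of "norm x" "norm y"]
    by (auto simp: norm_minus_commute)
qed

lemma norm_vector_scalar_mult:
  fixes v :: "complex ^ 'n"
  shows "norm (c *s v) = norm c * norm v"
  by (simp add: norm_vec_def norm_mult L2_set_right_distrib)

lemma norm_power_nonlin_diff_le:
  assumes "0 < p" "norm x \<le> R" "norm y \<le> R"
  shows "norm (power_nonlin p x - power_nonlin p y) \<le> (p + 2) * R powr p * norm (x - y)"
proof -
  have "norm (power_nonlin p x - power_nonlin p y) \<le> norm (((p + 2) * R powr p) *\<^sub>R (x - y))"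
  proof (rule norm_le_componentwise_cart)
    fix i
    have "norm (x $ i) \<le> R" "norm (y $ i) \<le> R"
      using assms order.trans[OF Finite_Cartesian_Product.norm_nth_le] by blast+
    then show "norm ((power_nonlin p x - power_nonlin p y) $ i) \<le>
        norm ((((p + 2) * R powr p) *\<^sub>R (x - y)) $ i)"
      using norm_powr_lipschitz[OF \<open>0 < p\<close>, of "x $ i" R "y $ i"] \<open>0 < p\<close>
      by (simp add: power_nonlin_def flip: scaleR_conv_of_real)
  qed
  then show ?thesis using \<open>0 < p\<close> by simp
qed

text \<open>
  The imaginary part of \<open>c\<close> drops out after symmetrization. Applied to neighbouring sites, this is the
  self-adjointness of the discrete Laplacian, so that only \<open>lam\<close> remains of the complex diffusion coefficient.
\<close>

lemma inner_complex_mult_symmetrized: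
  fixes c z w :: complex
  shows "z \<bullet> (c * w) + w \<bullet> (c * z) = 2 * Re c * (z \<bullet> w)"
  by (simp add: inner_complex_def algebra_simps)

locale truncated_lattice =
  fixes m :: nat and \<iota> :: "'n::finite \<Rightarrow> int"
    and lam \<mu> \<gamma> \<beta> k \<nu> p :: real and g :: "int \<Rightarrow> complex"
  assumes enumeration: "bij_betw \<iota> UNIV {- int m..int m}"
    and lam: "0 < lam" and k: "0 < k" and p: "0 < p" and lam_less: "4 * lam < \<gamma>"
begin

text \<open>
  With periodic boundary values, \<open>\<Lambda>\<close> is the discrete Laplacian of a cyclic permutation, and no
  reference to the enumeration of the indices remains.
\<close>

lemma lattice_Lambda_cyclic:
  obtains \<sigma> \<tau> :: "'n \<Rightarrow> 'n" where "bij \<sigma>" "\<And>i. \<tau> (\<sigma> i) = i"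
    "\<And>z i. lattice_Lambda \<iota> m z $ i = 2 * z $ i - z $ \<sigma> i - z $ \<tau> i"
proof -
  have inj: "inj \<iota>" and range: "range \<iota> = {- int m..int m}"
    using enumeration by (auto simp: bij_betw_def)
  have range': "- int m \<le> \<iota> i" "\<iota> i \<le> int m" for i
    using range by auto
  have right: "\<iota> (inv \<iota> j) = j" if "- int m \<le> j" "j \<le> int m" for j
    using that range by (intro f_inv_into_f) auto
  have left: "inv \<iota> (\<iota> i) = i" for i using inj by simp
  define \<sigma> where "\<sigma> i = inv \<iota> (if \<iota> i = int m then - int m else \<iota> i + 1)" for i
  define \<tau> where "\<tau> i = inv \<iota> (if \<iota> i = - int m then int m else \<iota> i - 1)" for i
  have \<sigma>: "\<iota> (\<sigma> i) = (if \<iota> i = int m then - int m else \<iota> i + 1)" for i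
    unfolding \<sigma>_def using range'[of i] by (intro right) auto
  have \<tau>\<sigma>: "\<tau> (\<sigma> i) = i" for i
  proof (cases "\<iota> i = int m")
    case True
    then show ?thesis by (simp add: \<tau>_def \<sigma> left flip: True)
  next
    case False
    then show ?thesis using range'[of i] by (simp add: \<tau>_def \<sigma> left)
  qed
  then have "inj \<sigma>" by (rule inj_on_inverseI)
  then have "bij \<sigma>" by (simp add: bij_def finite_UNIV_inj_surj)
  moreover have "lattice_Lambda \<iota> m z $ i = 2 * z $ i - z $ \<sigma> i - z $ \<tau> i" for z i
    using range'[of i] by (auto simp: lattice_Lambda_def coord_def \<sigma>_def \<tau>_def left)
  ultimately show ?thesis using that \<tau>\<sigma> by blast
qed

lemma inner_lattice_Lambda_le:
  "u \<bullet> (Complex lam \<mu> *s lattice_Lambda \<iota> m u) \<le> 4 * lam * (norm u)\<^sup>2"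
proof -
  obtain \<sigma> \<tau> :: "'n \<Rightarrow> 'n" where \<sigma>: "bij \<sigma>" "\<And>i. \<tau> (\<sigma> i) = i"
    and \<Lambda>: "\<And>z i. lattice_Lambda \<iota> m z $ i = 2 * z $ i - z $ \<sigma> i - z $ \<tau> i"
    using lattice_Lambda_cyclic by blast
  let ?c = "Complex lam \<mu>"
  have norm_u: "(norm u)\<^sup>2 = (\<Sum>i\<in>UNIV. (norm (u $ i))\<^sup>2)"
    by (simp add: power2_norm_eq_inner inner_vec_def)
  have shift: "(\<Sum>i\<in>UNIV. f (\<sigma> i)) = (\<Sum>i\<in>UNIV. f i)" for f :: "'n \<Rightarrow> real"
    using sum.reindex_bij_betw[OF \<sigma>(1), of f] by simp
  have diag: "u $ i \<bullet> (?c * (2 * u $ i)) = 2 * lam * (norm (u $ i))\<^sup>2" for i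
    unfolding cmod_power2 by (simp add: inner_complex_def algebra_simps power2_eq_square)
  have "u \<bullet> (?c *s lattice_Lambda \<iota> m u) =
      (\<Sum>i\<in>UNIV. 2 * lam * (norm (u $ i))\<^sup>2) - (\<Sum>i\<in>UNIV. u $ i \<bullet> (?c * u $ \<sigma> i))
        - (\<Sum>i\<in>UNIV. u $ i \<bullet> (?c * u $ \<tau> i))"
    by (simp add: inner_vec_def \<Lambda> right_diff_distrib inner_diff_right sum_subtractf diag)
  also have "(\<Sum>i\<in>UNIV. u $ i \<bullet> (?c * u $ \<tau> i)) = (\<Sum>i\<in>UNIV. u $ \<sigma> i \<bullet> (?c * u $ i))"
    using shift[of "\<lambda>i. u $ i \<bullet> (?c * u $ \<tau> i)"] by (simp add: \<sigma>(2))
  also have "(\<Sum>i\<in>UNIV. 2 * lam * (norm (u $ i))\<^sup>2) - (\<Sum>i\<in>UNIV. u $ i \<bullet> (?c * u $ \<sigma> i))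
        - (\<Sum>i\<in>UNIV. u $ \<sigma> i \<bullet> (?c * u $ i)) =
      (\<Sum>i\<in>UNIV. 2 * lam * (norm (u $ i))\<^sup>2 - (u $ i \<bullet> (?c * u $ \<sigma> i) + u $ \<sigma> i \<bullet> (?c * u $ i)))"
    by (simp add: sum_subtractf sum.distrib)
  also have "\<dots> \<le> (\<Sum>i\<in>UNIV. 2 * lam * (norm (u $ i))\<^sup>2 + lam * ((norm (u $ i))\<^sup>2 + (norm (u $ \<sigma> i))\<^sup>2))"
  proof (rule sum_mono)
    fix i
    have "- (2 * (u $ i \<bullet> u $ \<sigma> i)) \<le> 2 * (norm (u $ i) * norm (u $ \<sigma> i))"
      using Cauchy_Schwarz_ineq2[of "u $ i" "u $ \<sigma> i"] by linarith
    also have "\<dots> \<le> (norm (u $ i))\<^sup>2 + (norm (u $ \<sigma> i))\<^sup>2"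
      using sum_squares_bound[of "norm (u $ i)" "norm (u $ \<sigma> i)"] by simp
    finally have "lam * - (2 * (u $ i \<bullet> u $ \<sigma> i)) \<le> lam * ((norm (u $ i))\<^sup>2 + (norm (u $ \<sigma> i))\<^sup>2)"
      using lam by (intro mult_left_mono) auto
    then show "2 * lam * (norm (u $ i))\<^sup>2 - (u $ i \<bullet> (?c * u $ \<sigma> i) + u $ \<sigma> i \<bullet> (?c * u $ i)) \<le>
        2 * lam * (norm (u $ i))\<^sup>2 + lam * ((norm (u $ i))\<^sup>2 + (norm (u $ \<sigma> i))\<^sup>2)"
      unfolding inner_complex_mult_symmetrized by simp
  qed
  also have "\<dots> = 2 * lam * (norm u)\<^sup>2 + lam * ((norm u)\<^sup>2 + (norm u)\<^sup>2)"
    using shift[of "\<lambda>i. (norm (u $ i))\<^sup>2"] unfolding norm_u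
    by (simp add: sum.distrib flip: sum_distrib_left)
  finally show ?thesis by simp
qed

text \<open>
  Intensity and noise enter only through their product \<open>b = a * \<zeta>\<close>, and \<open>b = 0\<close> is the
  deterministic field. All fields are thereby members of one jointly continuous family, and the
  limit \<open>a \<rightarrow> 0\<close> is a statement about continuity of this family at \<open>b = 0\<close>.
\<close>

definition field :: "real \<Rightarrow> complex ^ 'n \<Rightarrow> complex ^ 'n" where
  "field b u = rand_field \<iota> m lam \<mu> \<gamma> \<beta> k \<nu> p g 1 b u"

lemma rand_field_eq: "rand_field \<iota> m lam \<mu> \<gamma> \<beta> k \<nu> p g a \<zeta> u = field (a * \<zeta>) u"
  by (simp add: field_def rand_field_def mult.assoc)

lemma det_field_eq: "det_field \<iota> m lam \<mu> \<gamma> \<beta> k \<nu> p g u = field 0 u"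
  by (simp add: field_def rand_field_def det_field_def)

definition lin :: "complex ^ 'n \<Rightarrow> complex ^ 'n" where
  "lin u = Complex lam \<mu> *s lattice_Lambda \<iota> m u - Complex \<gamma> \<beta> *s u"

abbreviation forcing :: "complex ^ 'n" where "forcing \<equiv> truncate_seq \<iota> g"

lemma field_split:
  "field b u = lin u + b *\<^sub>R u - Complex k \<nu> *s (exp (p * b) *\<^sub>R power_nonlin p u) + exp (- b) *\<^sub>R forcing"
  by (simp add: field_def rand_field_def lin_def algebra_simps)

lemma bounded_linear_lin: "bounded_linear lin"
  unfolding lin_def linear_conv_bounded_linear[symmetric]
  by (rule linearI)
     (simp_all add: vec_eq_iff lattice_Lambda_def coord_def algebra_simps)

text \<open>
  The dissipation that remains after the Laplacian, which enters with the amplifying sign and has norm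
  at most 4, has been absorbed.
\<close>

definition gap :: real where "gap = \<gamma> - 4 * lam"

lemma gap_pos: "0 < gap" using lam_less by (simp add: gap_def)

text \<open>
  Half of the remaining dissipation is spent on absorbing the forcing by Young's inequality, and
  the nonlinear term has a favourable sign.
\<close>

lemma energy_estimate:
  "2 * (u \<bullet> field b u) \<le> (2 * b - gap) * (norm u)\<^sup>2 + exp (- 2 * b) * (norm forcing)\<^sup>2 / gap"
proof -
  have damp: "u \<bullet> (Complex \<gamma> \<beta> *s u) = \<gamma> * (norm u)\<^sup>2"
  proof -
    have "u \<bullet> (Complex \<gamma> \<beta> *s u) = (\<Sum>i\<in>UNIV. \<gamma> * (norm (u $ i))\<^sup>2)"
      unfolding inner_vec_def cmod_power2
      by (intro sum.cong) (auto simp: inner_complex_def algebra_simps power2_eq_square)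
    then show ?thesis by (simp add: power2_norm_eq_inner inner_vec_def sum_distrib_left)
  qed
  have nonlin: "u \<bullet> (Complex k \<nu> *s (exp (p * b) *\<^sub>R power_nonlin p u)) \<ge> 0"
  proof -
    have "u $ i \<bullet> (Complex k \<nu> *s (exp (p * b) *\<^sub>R power_nonlin p u)) $ i =
        k * exp (p * b) * norm (u $ i) powr p * (norm (u $ i))\<^sup>2" for i
      unfolding cmod_power2
      by (simp add: power_nonlin_def inner_complex_def algebra_simps power2_eq_square)
    then show ?thesis unfolding inner_vec_def using k by (intro sum_nonneg) simp
  qed
  have "2 * (u \<bullet> (exp (- b) *\<^sub>R forcing)) \<le> 2 * (norm u * (exp (- b) * norm forcing))"
    using norm_cauchy_schwarz[of u "exp (- b) *\<^sub>R forcing"] by simp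
  also have "\<dots> \<le> gap * (norm u)\<^sup>2 + (exp (- b) * norm forcing)\<^sup>2 / gap"
  proof -
    have "0 \<le> (gap * norm u - exp (- b) * norm forcing)\<^sup>2 / gap" using gap_pos by simp
    also have "\<dots> = gap * (norm u)\<^sup>2 - 2 * (norm u * (exp (- b) * norm forcing)) +
        (exp (- b) * norm forcing)\<^sup>2 / gap"
      using gap_pos by (simp add: power2_eq_square field_simps)
    finally show ?thesis by simp
  qed
  also have "(exp (- b) * norm forcing)\<^sup>2 / gap = exp (- 2 * b) * (norm forcing)\<^sup>2 / gap"
    by (simp add: power_mult_distrib flip: exp_double)
  finally have force: "2 * (u \<bullet> (exp (- b) *\<^sub>R forcing)) \<le>
      gap * (norm u)\<^sup>2 + exp (- 2 * b) * (norm forcing)\<^sup>2 / gap" .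
  have "u \<bullet> field b u = u \<bullet> (Complex lam \<mu> *s lattice_Lambda \<iota> m u) - \<gamma> * (norm u)\<^sup>2 + b * (norm u)\<^sup>2
      - u \<bullet> (Complex k \<nu> *s (exp (p * b) *\<^sub>R power_nonlin p u)) + u \<bullet> (exp (- b) *\<^sub>R forcing)"
    unfolding field_split lin_def
    by (simp only: inner_add_right inner_diff_right damp inner_scaleR_right power2_norm_eq_inner)
  also have "\<dots> \<le> 4 * lam * (norm u)\<^sup>2 - \<gamma> * (norm u)\<^sup>2 + b * (norm u)\<^sup>2 + u \<bullet> (exp (- b) *\<^sub>R forcing)"
    using nonlin inner_lattice_Lambda_le[of u] by linarith
  finally have "2 * (u \<bullet> field b u) \<le> 2 * ((b - gap) * (norm u)\<^sup>2) + 2 * (u \<bullet> (exp (- b) *\<^sub>R forcing))"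
    by (simp add: gap_def algebra_simps)
  with force show ?thesis by (simp add: algebra_simps)
qed

lemma field_lipschitz:
  obtains L where "0 \<le> L" "\<And>b x y. \<bar>b\<bar> \<le> Z \<Longrightarrow> norm x \<le> R \<Longrightarrow> norm y \<le> R \<Longrightarrow>
    norm (field b x - field b y) \<le> L * norm (x - y)"
proof -
  obtain K where K: "0 < K" "\<And>u. norm (lin u) \<le> norm u * K"
    using bounded_linear.pos_bounded[OF bounded_linear_lin] by blast
  define L where "L = K + \<bar>Z\<bar> + norm (Complex k \<nu>) * exp (p * \<bar>Z\<bar>) * ((p + 2) * R powr p)"
  have "norm (field b x - field b y) \<le> L * norm (x - y)"
    if "\<bar>b\<bar> \<le> Z" "norm x \<le> R" "norm y \<le> R" for b x y
  proof -
    let ?N = "power_nonlin p x - power_nonlin p y"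
    have "field b x - field b y = lin (x - y) + b *\<^sub>R (x - y) - Complex k \<nu> *s (exp (p * b) *\<^sub>R ?N)"
      unfolding field_split
      by (simp add: linear_diff[OF bounded_linear.linear[OF bounded_linear_lin]] algebra_simps
          vector_ssub_ldistrib vector_add_ldistrib)
    also have "norm \<dots> \<le> norm (lin (x - y)) + norm (b *\<^sub>R (x - y)) +
        norm (Complex k \<nu> *s (exp (p * b) *\<^sub>R ?N))"
      by (rule order.trans[OF norm_triangle_ineq4]) (intro add_right_mono norm_triangle_ineq)
    also have "\<dots> \<le> norm (x - y) * K + \<bar>Z\<bar> * norm (x - y) +
        norm (Complex k \<nu>) * (exp (p * \<bar>Z\<bar>) * ((p + 2) * R powr p * norm (x - y)))"
    proof (intro add_mono)
      show "norm (b *\<^sub>R (x - y)) \<le> \<bar>Z\<bar> * norm (x - y)"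
        using that(1) by (auto intro: mult_right_mono)
      have "norm (exp (p * b) *\<^sub>R ?N) \<le> exp (p * \<bar>Z\<bar>) * ((p + 2) * R powr p * norm (x - y))"
        using that p norm_power_nonlin_diff_le[OF p that(2,3)]
        unfolding norm_scaleR by (intro mult_mono) auto
      then show "norm (Complex k \<nu> *s (exp (p * b) *\<^sub>R ?N)) \<le>
          norm (Complex k \<nu>) * (exp (p * \<bar>Z\<bar>) * ((p + 2) * R powr p * norm (x - y)))"
        unfolding norm_vector_scalar_mult by (rule mult_left_mono) simp
    qed (rule K)
    finally show ?thesis by (simp add: L_def algebra_simps)
  qed
  moreover have "0 \<le> L" using K p by (simp add: L_def)
  ultimately show ?thesis using that by blast
qed

lemma continuous_on_power_nonlin: "continuous_on A (power_nonlin p :: complex ^ 'n \<Rightarrow> _)"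
  unfolding power_nonlin_def using p
  by (intro continuous_on_vec_lambda continuous_intros continuous_on_powr') auto

lemma continuous_on_vector_scalar_mult:
  fixes f :: "'b::topological_space \<Rightarrow> complex ^ 'n"
  assumes "continuous_on A f"
  shows "continuous_on A (\<lambda>x. c *s f x)"
  unfolding vector_scalar_mult_def using assms
  by (intro continuous_on_vec_lambda continuous_intros) auto

lemma continuous_on_field: "continuous_on A (\<lambda>(b, x). field b x)"
  unfolding field_split case_prod_unfold
  by (intro continuous_intros continuous_on_vector_scalar_mult
      bounded_linear.continuous_on[OF bounded_linear_lin]
      continuous_on_compose2[OF continuous_on_power_nonlin[of UNIV]]) auto

lemma field_growth:
  obtains C where "0 < C" "\<And>b x. \<bar>b\<bar> \<le> Z \<Longrightarrow> x \<bullet> field b x \<le> C * (1 + (norm x)\<^sup>2)"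
proof -
  define C where "C = 1 + \<bar>Z\<bar> + exp (2 * \<bar>Z\<bar>) * (norm forcing)\<^sup>2 / gap"
  have nonneg: "0 \<le> exp (2 * \<bar>Z\<bar>) * (norm forcing)\<^sup>2 / gap" using gap_pos by simp
  have "x \<bullet> field b x \<le> C * (1 + (norm x)\<^sup>2)" if "\<bar>b\<bar> \<le> Z" for b x
  proof -
    have b: "b \<le> \<bar>Z\<bar>" "- b \<le> \<bar>Z\<bar>" using that by auto
    have "2 * (x \<bullet> field b x) \<le> (2 * b - gap) * (norm x)\<^sup>2 + exp (- 2 * b) * (norm forcing)\<^sup>2 / gap"
      by (rule energy_estimate)
    also have "\<dots> \<le> (2 * \<bar>Z\<bar>) * (norm x)\<^sup>2 + exp (2 * \<bar>Z\<bar>) * (norm forcing)\<^sup>2 / gap"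
      using b gap_pos by (intro add_mono mult_right_mono divide_right_mono) auto
    also have "\<dots> \<le> 2 * C * (norm x)\<^sup>2 + 2 * C"
      using nonneg by (intro add_mono mult_right_mono) (auto simp: C_def)
    finally show ?thesis by (simp add: algebra_simps)
  qed
  moreover have "0 < C" unfolding C_def using nonneg by linarith
  ultimately show ?thesis using that by blast
qed

lemma dissipative_field_field:
  assumes q: "continuous_on {0..} q"
  shows "dissipative_field (\<lambda>t. field (q t))"
proof -
  have bound: "\<exists>Z. \<forall>t\<in>{0..T}. \<bar>q t\<bar> \<le> Z" for T
  proof -
    have "compact (q ` {0..T})"
      by (intro compact_continuous_image continuous_on_subset[OF q]) auto
    then show ?thesis
      using compact_imp_bounded by (fastforce simp: bounded_iff)
  qed
  show ?thesis
  proof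
    show "continuous_on ({0..} \<times> UNIV) (\<lambda>(t, x). field (q t) x)"
    proof -
      have "continuous_on ({0..} \<times> UNIV) (\<lambda>z. (\<lambda>(b, x). field b x) (q (fst z), snd z :: complex ^ 'n))"
        by (intro continuous_on_compose2[OF continuous_on_field[of UNIV]] continuous_intros
            continuous_on_compose2[OF q]) auto
      then show ?thesis by (simp add: case_prod_unfold)
    qed
  next
    fix T R
    obtain Z where "\<forall>t\<in>{0..T}. \<bar>q t\<bar> \<le> Z" using bound by blast
    then show "\<exists>L. \<forall>t\<in>{0..T}. \<forall>x\<in>cball 0 R. \<forall>y\<in>cball 0 R.
        norm (field (q t) x - field (q t) y) \<le> L * norm (x - y)"
      by (rule_tac field_lipschitz[of Z R]) (meson mem_cball_0)
  next
    fix T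
    obtain Z where "\<forall>t\<in>{0..T}. \<bar>q t\<bar> \<le> Z" using bound by blast
    then show "\<exists>C. \<forall>t\<in>{0..T}. \<forall>x. x \<bullet> field (q t) x \<le> C * (1 + (norm x)\<^sup>2)"
      by (rule_tac field_growth[of Z]) blast
  qed
qed

end

section \<open>The deterministic semiflow and the limit of vanishing noise\<close>

lemma sublinear_bound:
  fixes f :: "real \<Rightarrow> real"
  assumes cont: "continuous_on {..0} f"
    and lim: "((\<lambda>t. \<bar>f t\<bar> / \<bar>t\<bar>) \<longlongrightarrow> 0) at_bot" and "0 < \<epsilon>"
  obtains C where "\<And>t. t \<le> 0 \<Longrightarrow> \<bar>f t\<bar> \<le> C + \<epsilon> * \<bar>t\<bar>"
proof -
  have "\<forall>\<^sub>F t in at_bot. \<bar>f t\<bar> / \<bar>t\<bar> < \<epsilon>"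
    using order_tendstoD(2)[OF lim \<open>0 < \<epsilon>\<close>] .
  then obtain T0 where T0: "\<And>t. t \<le> T0 \<Longrightarrow> \<bar>f t\<bar> / \<bar>t\<bar> < \<epsilon>"
    by (auto simp: eventually_at_bot_linorder)
  define T where "T = min T0 (-1)"
  have "compact (f ` {T..0})"
    by (intro compact_continuous_image continuous_on_subset[OF cont]) auto
  then obtain C where C: "\<And>t. t \<in> {T..0} \<Longrightarrow> \<bar>f t\<bar> \<le> C"
    using compact_imp_bounded by (fastforce simp: bounded_iff)
  have C0: "0 \<le> C" using C[of 0] abs_ge_zero[of "f 0"] unfolding T_def by fastforce
  have "\<bar>f t\<bar> \<le> C + \<epsilon> * \<bar>t\<bar>" if "t \<le> 0" for t
  proof (cases "t < T")
    case True
    then have "\<bar>f t\<bar> / \<bar>t\<bar> < \<epsilon>" "0 < \<bar>t\<bar>"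
      using T0[of t] by (auto simp: T_def)
    then have "\<bar>f t\<bar> < \<epsilon> * \<bar>t\<bar>" by (simp only: pos_divide_less_eq)
    with C0 show ?thesis by simp
  next
    case False
    then have "\<bar>f t\<bar> \<le> C" using C that by simp
    then show ?thesis using \<open>0 < \<epsilon>\<close> by (simp add: add_increasing2)
  qed
  then show ?thesis using that by blast
qed

context truncated_lattice
begin

abbreviation flow :: "(real \<Rightarrow> real) \<Rightarrow> real \<Rightarrow> complex ^ 'n \<Rightarrow> complex ^ 'n" where
  "flow q \<equiv> solution_op (\<lambda>t. field (q t))"

lemma flow_solution:
  assumes "continuous_on {0..} q"
  shows "\<exists>u. ivp_solution (\<lambda>t. field (q t)) x u \<and> (\<forall>t\<ge>0. flow q t x = u t) \<and> u 0 = x"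
proof -
  interpret dissipative_field "\<lambda>t. field (q t)" using assms by (rule dissipative_field_field)
  obtain u where u: "ivp_solution (\<lambda>t. field (q t)) x u" using exists_ivp_solution by blast
  moreover have "\<forall>t\<ge>0. flow q t x = u t" using solution_op_eq[OF u] by simp
  moreover have "u 0 = x" using u by (simp add: ivp_solution_def)
  ultimately show ?thesis by blast
qed

text \<open>
  A constant \<open>K\<close> and a radius \<open>R'\<close> that depend on \<open>T\<close> and \<open>R\<close>, but not on the coefficient functions: this
  uniformity is what allows the coefficient \<open>a * q\<close> to tend to 0 later. The bound 1 on the
  coefficients is an arbitrary normalization.
\<close>

definition stability_constants :: "real \<Rightarrow> real \<Rightarrow> real \<Rightarrow> real \<Rightarrow> bool" where
  "stability_constants T R R' K \<longleftrightarrow> (\<forall>q1 q2 x y \<eta>.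
    continuous_on {0..} q1 \<longrightarrow> continuous_on {0..} q2 \<longrightarrow>
    (\<forall>t\<in>{0..T}. \<bar>q1 t\<bar> \<le> 1) \<longrightarrow> (\<forall>t\<in>{0..T}. \<bar>q2 t\<bar> \<le> 1) \<longrightarrow>
    norm x \<le> R \<longrightarrow> norm y \<le> R \<longrightarrow>
    (\<forall>t\<in>{0..T}. \<forall>z\<in>cball 0 R'. norm (field (q1 t) z - field (q2 t) z) \<le> \<eta>) \<longrightarrow>
    (norm (flow q1 T x - flow q2 T y))\<^sup>2 \<le> ((norm (x - y))\<^sup>2 + \<eta>\<^sup>2) * K)"

lemma stability_constantsD:
  assumes "stability_constants T R R' K"
    and "continuous_on {0..} q1" "continuous_on {0..} q2"
    and "\<And>t. t \<in> {0..T} \<Longrightarrow> \<bar>q1 t\<bar> \<le> 1" "\<And>t. t \<in> {0..T} \<Longrightarrow> \<bar>q2 t\<bar> \<le> 1"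
    and "norm x \<le> R" "norm y \<le> R"
    and "\<And>t z. t \<in> {0..T} \<Longrightarrow> z \<in> cball 0 R' \<Longrightarrow> norm (field (q1 t) z - field (q2 t) z) \<le> \<eta>"
  shows "(norm (flow q1 T x - flow q2 T y))\<^sup>2 \<le> ((norm (x - y))\<^sup>2 + \<eta>\<^sup>2) * K"
  using assms unfolding stability_constants_def by blast

lemma exists_stability_constants:
  assumes "0 \<le> T"
  shows "\<exists>K>0. \<exists>R'. stability_constants T R R' K"
proof -
  obtain C where C: "0 < C" "\<And>b x. \<bar>b\<bar> \<le> 1 \<Longrightarrow> x \<bullet> field b x \<le> C * (1 + (norm x)\<^sup>2)"
    using field_growth[of 1] by metis
  define R' where "R' = (R\<^sup>2 + 1) * exp (2 * C * T)"
  obtain L where L: "0 \<le> L" "\<And>b x y. \<bar>b\<bar> \<le> 1 \<Longrightarrow> norm x \<le> R' \<Longrightarrow> norm y \<le> R' \<Longrightarrow>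
      norm (field b x - field b y) \<le> L * norm (x - y)"
    using field_lipschitz[of 1 R'] by metis
  have "stability_constants T R R' (exp ((2 * L + 1) * T))"
    unfolding stability_constants_def
  proof (intro allI impI)
    fix q1 q2 :: "real \<Rightarrow> real" and x y :: "complex ^ 'n" and \<eta> :: real
    assume q1: "continuous_on {0..} q1" "\<forall>t\<in>{0..T}. \<bar>q1 t\<bar> \<le> 1"
      and q2: "continuous_on {0..} q2" "\<forall>t\<in>{0..T}. \<bar>q2 t\<bar> \<le> 1"
      and xy: "norm x \<le> R" "norm y \<le> R"
      and close: "\<forall>t\<in>{0..T}. \<forall>z\<in>cball 0 R'. norm (field (q1 t) z - field (q2 t) z) \<le> \<eta>"
    obtain u where u: "ivp_solution (\<lambda>t. field (q1 t)) x u" "flow q1 T x = u T" "u 0 = x"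
      using flow_solution[OF q1(1)] \<open>0 \<le> T\<close> by blast
    obtain v where v: "ivp_solution (\<lambda>t. field (q2 t)) y v" "flow q2 T y = v T" "v 0 = y"
      using flow_solution[OF q2(1)] \<open>0 \<le> T\<close> by blast
    have bounded: "w t \<in> cball 0 R'"
      if w: "solves_on (\<lambda>t. field (q t)) T w" "norm (w 0) \<le> R"
        and q: "\<forall>t\<in>{0..T}. \<bar>q t\<bar> \<le> 1" and t: "t \<in> {0..T}" for w q t
    proof -
      have "norm (w t) \<le> ((norm (w 0))\<^sup>2 + 1) * exp (2 * C * T)"
        using C(2) q by (intro growth_bound[OF C(1) w(1) t]) blast
      also have "\<dots> \<le> R'"
        unfolding R'_def using w(2) by (intro mult_right_mono add_right_mono power_mono) auto
      finally show ?thesis by simp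
    qed
    note us = ivp_solution_solves_on[OF u(1)] and vs = ivp_solution_solves_on[OF v(1)]
    have "(norm (u T - v T))\<^sup>2 \<le> ((norm (u 0 - v 0))\<^sup>2 + \<eta>\<^sup>2) * exp ((2 * L + 1) * T)"
    proof (rule solutions_stay_close[OF \<open>0 \<le> T\<close> L(1) us _ vs])
      show ub: "u t \<in> cball 0 R'" if "t \<in> {0..T}" for t
        using bounded[OF us _ q1(2) that] xy u by simp
      show vb: "v t \<in> cball 0 R'" if "t \<in> {0..T}" for t
        using bounded[OF vs _ q2(2) that] xy v by simp
      show "norm (field (q1 t) (v t) - field (q2 t) (v t)) \<le> \<eta>" if "t \<in> {0..T}" for t
        using close that vb[OF that] by blast
    qed (use L q1(2) in auto)
    then show "(norm (flow q1 T x - flow q2 T y))\<^sup>2 \<le>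
        ((norm (x - y))\<^sup>2 + \<eta>\<^sup>2) * exp ((2 * L + 1) * T)"
      by (simp add: u v)
  qed
  moreover have "0 < exp ((2 * L + 1) * T)" by simp
  ultimately show ?thesis by blast
qed

abbreviation semiflow :: "real \<Rightarrow> complex ^ 'n \<Rightarrow> complex ^ 'n" where
  "semiflow \<equiv> flow (\<lambda>_. 0)"

lemma continuous_on_semiflow:
  assumes "0 \<le> T"
  shows "continuous_on (cball 0 R) (semiflow T)"
proof -
  obtain K R' where K: "0 < K" "stability_constants T R R' K"
    using exists_stability_constants[OF assms] by blast
  have "(sqrt K)-lipschitz_on (cball 0 R) (semiflow T)"
  proof (rule lipschitz_onI)
    fix x y :: "complex ^ 'n" assume "x \<in> cball 0 R" "y \<in> cball 0 R"
    then have "(norm (semiflow T x - semiflow T y))\<^sup>2 \<le> ((norm (x - y))\<^sup>2 + 0\<^sup>2) * K"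
      by (intro stability_constantsD[OF K(2)]) auto
    also have "\<dots> = (sqrt K * norm (x - y))\<^sup>2"
      using K(1) by (simp add: power_mult_distrib mult.commute)
    finally show "dist (semiflow T x) (semiflow T y) \<le> sqrt K * dist x y"
      unfolding dist_norm by (rule power2_le_imp_le) (use K(1) in simp)
  qed (use K in simp)
  then show ?thesis by (rule lipschitz_on_continuous_on)
qed

lemma semiflow_norm_bound:
  assumes "0 \<le> T"
  shows "(norm (semiflow T x))\<^sup>2 - (norm forcing)\<^sup>2 / gap\<^sup>2 \<le>
    ((norm x)\<^sup>2 - (norm forcing)\<^sup>2 / gap\<^sup>2) * exp (- gap * T)"
proof -
  obtain u where u: "ivp_solution (\<lambda>_. field 0) x u" "semiflow T x = u T" "u 0 = x"
    using flow_solution[OF continuous_on_const] assms by blast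
  have le: "2 * (u t \<bullet> field 0 (u t)) \<le> (- gap) * (norm (u t))\<^sup>2 + (norm forcing)\<^sup>2 / gap" for t
    using energy_estimate[of "u t" 0] by simp
  have "(norm (u T))\<^sup>2 + (norm forcing)\<^sup>2 / gap / (- gap) \<le>
      ((norm (u 0))\<^sup>2 + (norm forcing)\<^sup>2 / gap / (- gap)) * exp (- gap * T)"
    by (rule gronwall[OF assms _ solves_on_norm_squared_deriv[OF ivp_solution_solves_on[OF u(1)]] le])
       (use gap_pos in auto)
  then show ?thesis by (simp add: u power2_eq_square)
qed

text \<open>
  The squared norm decays exponentially to at most \<open>(norm forcing)\<^sup>2 / gap\<^sup>2\<close>, so any slightly larger ball is
  absorbing and positively invariant.
\<close>

lemma exists_semiflow_attractor: "\<exists>A. global_attractor semiflow A"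
proof -
  define K where "K = (norm forcing)\<^sup>2 / gap\<^sup>2"
  have "K \<ge> 0" by (simp add: K_def)
  define B where "B = cball (0 :: complex ^ 'n) (sqrt (K + 1))"
  have B_iff: "x \<in> B \<longleftrightarrow> (norm x)\<^sup>2 \<le> K + 1" for x
    unfolding B_def by (auto intro: real_le_rsqrt simp: real_le_lsqrt sqrt_ge_absD)
  note bound = semiflow_norm_bound[folded K_def]
  have "global_attractor semiflow (\<Inter>n. semiflow (real n) ` B)"
  proof (rule semigroup_global_attractor)
    show "compact B" "B \<noteq> {}" using \<open>K \<ge> 0\<close> by (auto simp: B_def)
    show "continuous_on B (semiflow t)" if "0 \<le> t" for t
      unfolding B_def using that by (rule continuous_on_semiflow)
    show "semiflow (s + t) x = semiflow s (semiflow t x)" if "0 \<le> s" "0 \<le> t" for s t x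
      by (rule solution_op_semigroup[OF dissipative_field_field that]) simp
    show "semiflow t ` B \<subseteq> B" if t: "0 \<le> t" for t
    proof (rule image_subsetI)
      fix x assume "x \<in> B"
      have "(norm (semiflow t x))\<^sup>2 - K \<le> ((norm x)\<^sup>2 - K) * exp (- gap * t)"
        by (rule bound[OF t])
      also have "\<dots> \<le> 1 * exp (- gap * t)"
        using \<open>x \<in> B\<close> by (intro mult_right_mono) (auto simp: B_iff)
      also have "\<dots> \<le> 1" using gap_pos t by simp
      finally show "semiflow t x \<in> B" by (simp add: B_iff)
    qed
    fix D :: "(complex ^ 'n) set" assume "bounded D"
    then obtain M where M: "\<And>x. x \<in> D \<Longrightarrow> norm x \<le> M" by (auto simp: bounded_iff)
    \<comment> \<open>long enough for \<open>M\<^sup>2 * exp (- gap * T) \<le> 1\<close>, because \<open>s \<le> exp s\<close>\<close>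
    define T where "T = M\<^sup>2 / gap"
    have T: "0 \<le> T" using gap_pos by (simp add: T_def)
    have "semiflow T x \<in> B" if "x \<in> D" for x
    proof -
      have "(norm (semiflow T x))\<^sup>2 - K \<le> ((norm x)\<^sup>2 - K) * exp (- gap * T)"
        by (rule bound[OF T])
      also have "\<dots> \<le> exp (gap * T) * exp (- gap * T)"
      proof (rule mult_right_mono)
        have "(norm x)\<^sup>2 - K \<le> M\<^sup>2"
          using power_mono[OF M[OF that], of 2] \<open>K \<ge> 0\<close> by simp
        also have "\<dots> = gap * T" using gap_pos by (simp add: T_def)
        also have "\<dots> \<le> exp (gap * T)" using exp_ge_add_one_self[of "gap * T"] by linarith
        finally show "(norm x)\<^sup>2 - K \<le> exp (gap * T)" .
      qed simp
      also have "\<dots> = 1" by (simp flip: exp_add)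
      finally show ?thesis by (simp add: B_iff)
    qed
    with T show "\<exists>T\<ge>0. semiflow T ` D \<subseteq> B" by blast
  qed
  then show ?thesis by blast
qed

text \<open>
  On \<open>{0..T}\<close> the coefficient \<open>a * q\<close> tends to 0 uniformly, and the field is uniformly continuous on the
  compact set of coefficients in \<open>{-1..1}\<close> and points in the ball that contains all solutions involved.
\<close>

lemma flow_tends_to_semiflow:
  assumes q: "continuous_on {0..} q" and "0 \<le> T" and "0 < e"
  shows "\<forall>\<^sub>F a in at_right 0. \<forall>x\<in>cball 0 R. norm (flow (\<lambda>t. a * q t) T x - semiflow T x) < e"
proof -
  obtain K R' where K: "0 < K" "stability_constants T R R' K"
    using exists_stability_constants[OF \<open>0 \<le> T\<close>] by blast
  define \<eta> where "\<eta> = e / (2 * sqrt K)"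
  have \<eta>: "0 < \<eta>" using K \<open>0 < e\<close> by (simp add: \<eta>_def)
  have "uniformly_continuous_on ({-1..1} \<times> cball 0 R') (\<lambda>(b, x). field b x)"
    by (intro compact_uniformly_continuous continuous_on_field compact_Times) auto
  then obtain h where h: "0 < h" "\<And>b c z. b \<in> {-1..1} \<Longrightarrow> c \<in> {-1..1} \<Longrightarrow> z \<in> cball 0 R' \<Longrightarrow>
      dist b c < h \<Longrightarrow> dist (field b z) (field c z) < \<eta>"
    using \<eta> unfolding uniformly_continuous_on_def by (fastforce simp: dist_Pair_Pair)
  have "compact (q ` {0..T})"
    by (intro compact_continuous_image continuous_on_subset[OF q]) auto
  then obtain Z where Z: "0 < Z" "\<And>t. t \<in> {0..T} \<Longrightarrow> \<bar>q t\<bar> \<le> Z"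
    using compact_imp_bounded bounded_pos by (metis imageI real_norm_def)
  define a1 where "a1 = min 1 h / Z"
  have "0 < a1" using Z h by (simp add: a1_def)
  then have "\<forall>\<^sub>F a in at_right 0. a \<in> {0<..<a1}" by (intro eventually_at_right_real)
  then show ?thesis
  proof eventually_elim
    case (elim a)
    have small: "\<bar>a * q t\<bar> < min 1 h" if "t \<in> {0..T}" for t
    proof -
      have "\<bar>a * q t\<bar> \<le> a * Z" using Z(2)[OF that] elim by (simp add: abs_mult)
      also have "\<dots> < min 1 h" using elim Z(1) by (simp add: a1_def pos_less_divide_eq)
      finally show ?thesis .
    qed
    show ?case
    proof
      fix x :: "complex ^ 'n" assume x: "x \<in> cball 0 R"
      have "(norm (flow (\<lambda>t. a * q t) T x - semiflow T x))\<^sup>2 \<le> ((norm (x - x))\<^sup>2 + \<eta>\<^sup>2) * K"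
      proof (rule stability_constantsD[OF K(2)])
        show "continuous_on {0..} (\<lambda>t. a * q t)" by (intro continuous_intros q)
        show "norm (field (a * q t) z - field 0 z) \<le> \<eta>" if "t \<in> {0..T}" "z \<in> cball 0 R'" for t z
          using h(2)[of "a * q t" 0 z] small[OF that(1)] that by (auto simp: dist_norm abs_less_iff)
        show "\<bar>a * q t\<bar> \<le> 1" if "t \<in> {0..T}" for t
          using small[OF that] by simp
      qed (use x in auto)
      also have "\<dots> = (e / 2)\<^sup>2" using K(1) by (simp add: \<eta>_def power_divide power_mult_distrib)
      finally have "norm (flow (\<lambda>t. a * q t) T x - semiflow T x) \<le> e / 2"
        by (rule power2_le_imp_le) (use \<open>0 < e\<close> in simp)
      then show "norm (flow (\<lambda>t. a * q t) T x - semiflow T x) < e" using \<open>0 < e\<close> by simp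
    qed
  qed
qed

text \<open>
  Let \<open>u\<close> be the solution and \<open>F = (norm forcing)\<^sup>2 / gap\<close>. In the time
  \<open>r = s - t\<close> of the path, the energy estimate says that \<open>(norm u)\<^sup>2 * exp (gap * r - 2 * a * Q r)\<close>
  grows at most at the rate \<open>F * exp (gap * r - 2 * a * Q r - 2 * a * q r)\<close>. If \<open>a * Q\<close> and \<open>a * q\<close> are
  bounded by \<open>1 + gap / 8 * \<bar>r\<bar>\<close>, this is below \<open>F * exp (4 + gap / 2 * r)\<close>, whose integral over \<open>r \<le> 0\<close> is finite.
  The contribution of the forcing is thus bounded independently of the path and of \<open>a\<close>.
\<close>

lemma pullback_bound:
  assumes "0 < a" "0 \<le> t"
    and q: "continuous_on UNIV q"
    and Q: "\<And>r. r \<in> {-t..0} \<Longrightarrow> (Q has_real_derivative q r) (at r within {-t..0})" "Q 0 = 0"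
    and Q_bound: "\<And>r. r \<le> 0 \<Longrightarrow> \<bar>a * Q r\<bar> \<le> 1 + gap / 8 * \<bar>r\<bar>"
    and q_bound: "\<And>r. r \<le> 0 \<Longrightarrow> \<bar>a * q r\<bar> \<le> 1 + gap / 8 * \<bar>r\<bar>"
  shows "(norm (flow (\<lambda>s. a * q (s - t)) t x))\<^sup>2 \<le>
    (norm x)\<^sup>2 * exp (2 - 3 / 4 * gap * t) + 2 * exp 4 * (norm forcing)\<^sup>2 / gap\<^sup>2"
proof -
  have q_cont: "continuous_on {0..} (\<lambda>s. a * q (s - t))"
    by (intro continuous_intros continuous_on_compose2[OF q]) auto
  then obtain u where u: "ivp_solution (\<lambda>s. field (a * q (s - t))) x u"
    "flow (\<lambda>s. a * q (s - t)) t x = u t" "u 0 = x"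
    using flow_solution[OF q_cont] \<open>0 \<le> t\<close> by blast
  define E where "E s = exp (gap * (s - t) - 2 * a * Q (s - t))" for s
  define F where "F = (norm forcing)\<^sup>2 / gap"
  have F: "F \<ge> 0" using gap_pos by (simp add: F_def)
  have Q': "((\<lambda>s. Q (s - t)) has_real_derivative q (s - t)) (at s within {0..t})"
    if s: "s \<in> {0..t}" for s
  proof -
    have "(\<lambda>s. s - t) ` {0..t} = {-t..0}"
      using image_add_atLeastAtMost[of "-t" 0 t] by (simp add: add.commute)
    then have "(Q \<circ> (\<lambda>s. s - t) has_real_derivative q (s - t) * 1) (at s within {0..t})"
      using s by (intro DERIV_image_chain) (auto intro!: Q derivative_eq_intros)
    then show ?thesis by (simp add: o_def)
  qed
  have "(norm (u t))\<^sup>2 * E t - (norm (u 0))\<^sup>2 * E 0 \<le>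
      2 * exp 4 * F / gap * exp (gap / 2 * (t - t)) - 2 * exp 4 * F / gap * exp (gap / 2 * (0 - t))"
  proof (rule deriv_le_imp_increment_le[OF \<open>0 \<le> t\<close>])
    fix s assume s: "s \<in> {0..t}"
    show "((\<lambda>s. (norm (u s))\<^sup>2 * E s) has_real_derivative
        2 * (u s \<bullet> field (a * q (s - t)) (u s)) * E s +
        E s * (gap - 2 * a * q (s - t)) * (norm (u s))\<^sup>2) (at s within {0..t})"
      unfolding E_def
      by (rule derivative_eq_intros solves_on_norm_squared_deriv[OF ivp_solution_solves_on[OF u(1)] s]
            Q'[OF s] refl | simp)+
    show "((\<lambda>s. 2 * exp 4 * F / gap * exp (gap / 2 * (s - t))) has_real_derivative
        exp 4 * F * exp (gap / 2 * (s - t))) (at s within {0..t})"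
      using gap_pos by (auto intro!: derivative_eq_intros)
    have "2 * (u s \<bullet> field (a * q (s - t)) (u s)) * E s +
        E s * (gap - 2 * a * q (s - t)) * (norm (u s))\<^sup>2 =
        E s * (2 * (u s \<bullet> field (a * q (s - t)) (u s)) + (gap - 2 * (a * q (s - t))) * (norm (u s))\<^sup>2)"
      by (simp add: algebra_simps)
    also have "\<dots> \<le> E s * (exp (- 2 * (a * q (s - t))) * F)"
      using energy_estimate[of "u s" "a * q (s - t)"]
      by (intro mult_left_mono) (auto simp: E_def F_def algebra_simps)
    also have "\<dots> = exp (gap * (s - t) - 2 * (a * Q (s - t)) - 2 * (a * q (s - t))) * F"
      by (simp add: E_def exp_diff exp_minus field_simps flip: exp_add)
    also have "\<dots> \<le> exp (4 + gap / 2 * (s - t)) * F"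
    proof -
      have "s - t \<le> 0" using s by simp
      then have "\<bar>a * Q (s - t)\<bar> \<le> 1 + gap * (t - s) / 8" "\<bar>a * q (s - t)\<bar> \<le> 1 + gap * (t - s) / 8"
        using Q_bound[of "s - t"] q_bound[of "s - t"] by auto
      moreover have "gap * (t - s) = - (gap * (s - t))" by (simp add: algebra_simps)
      ultimately have "gap * (s - t) - 2 * (a * Q (s - t)) - 2 * (a * q (s - t)) \<le> 4 + gap * (s - t) / 2"
        unfolding abs_le_iff by linarith
      then show ?thesis using F by (intro mult_right_mono) auto
    qed
    finally show "2 * (u s \<bullet> field (a * q (s - t)) (u s)) * E s +
        E s * (gap - 2 * a * q (s - t)) * (norm (u s))\<^sup>2 \<le> exp 4 * F * exp (gap / 2 * (s - t))"
      by (simp add: exp_add mult.commute mult.left_commute)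
  qed
  moreover have "E t = 1" by (simp add: E_def Q)
  ultimately have "(norm (u t))\<^sup>2 - (norm (u 0))\<^sup>2 * E 0 \<le>
      2 * exp 4 * F / gap - 2 * exp 4 * F / gap * exp (gap / 2 * (0 - t))" by simp
  moreover have "2 * exp 4 * F / gap * exp (gap / 2 * (0 - t)) \<ge> 0" using F gap_pos by simp
  moreover have "(norm (u 0))\<^sup>2 * E 0 \<le> (norm x)\<^sup>2 * exp (2 - 3 / 4 * gap * t)"
  proof -
    have "gap * (0 - t) - 2 * a * Q (0 - t) \<le> 2 - 3 / 4 * gap * t"
      using Q_bound[of "- t"] \<open>0 \<le> t\<close> by (auto simp: abs_le_iff algebra_simps)
    then show ?thesis unfolding E_def u(3) by (intro mult_left_mono) auto
  qed
  ultimately have "(norm (u t))\<^sup>2 \<le> (norm x)\<^sup>2 * exp (2 - 3 / 4 * gap * t) + 2 * exp 4 * F / gap"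
    by linarith
  then show ?thesis by (simp add: u F_def power2_eq_square)
qed

end

section \<open>Convergence of the random attractors\<close>

lemma path_shift_path_shift: "path_shift s (path_shift t \<omega>) = path_shift (s + t) \<omega>"
  by (auto simp: path_shift_def fun_eq_iff algebra_simps)

lemma admissible_paths_shift:
  assumes "admissible_paths P \<Omega>" "\<omega> \<in> \<Omega>"
  shows "path_shift t \<omega> \<in> \<Omega>"
  using assms unfolding admissible_paths_def by blast

text \<open>
  Every shifted path vanishes at 0, and by shift invariance every admissible path is a shifted one.
\<close>

lemma admissible_paths_shift_0:
  assumes "admissible_paths P \<Omega>" "\<omega> \<in> \<Omega>"
  shows "path_shift 0 \<omega> = \<omega>"
proof -
  obtain \<omega>' where "\<omega> = path_shift 0 \<omega>'"
    using assms unfolding admissible_paths_def by blast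
  then show ?thesis by (simp add: path_shift_path_shift)
qed

lemma space_restrict_admissible:
  assumes "admissible_paths P \<Omega>"
  shows "space (restrict_space P \<Omega>) = \<Omega>"
  using assms sets.sets_into_space[of \<Omega> P]
  by (auto simp: admissible_paths_def space_restrict_space)

lemma OU_path_continuous:
  assumes "admissible_paths P \<Omega>" "\<omega> \<in> \<Omega>"
  shows "continuous_on A (\<lambda>t. OU (path_shift t \<omega>))"
  using assms continuous_on_subset unfolding admissible_paths_def by blast

text \<open>
  The two limits at \<open>-\<infinity>\<close> in the definition of admissible paths say exactly that the process and its
  oriented integral are sublinear in the past; continuity takes care of a bounded time interval.
\<close>

lemma OU_integral_sublinear:
  assumes adm: "admissible_paths P \<Omega>" and \<omega>: "\<omega> \<in> \<Omega>" and "0 < \<epsilon>"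
  defines "q \<equiv> \<lambda>r. OU (path_shift r \<omega>)"
  obtains Q C where "\<And>t r. r \<in> {-t..0} \<Longrightarrow> (Q has_real_derivative q r) (at r within {-t..0})"
    "Q 0 = 0"
    "\<And>r. r \<le> 0 \<Longrightarrow> \<bar>Q r\<bar> \<le> C + \<epsilon> * \<bar>r\<bar>" "\<And>r. r \<le> 0 \<Longrightarrow> \<bar>q r\<bar> \<le> C + \<epsilon> * \<bar>r\<bar>"
proof -
  have q: "continuous_on A q" for A
    unfolding q_def by (rule OU_path_continuous[OF adm \<omega>])
  define Q where "Q r = (LBINT s=0..r. q s)" for r :: real
  have Q': "(Q has_real_derivative q r) (at r within {-t..0})" if "r \<in> {-t..0}" for t r
    unfolding Q_def has_real_derivative_iff_has_vector_derivative
    using interval_integral_FTC2[of "-t" 0 0 q r] q that by (simp add: zero_ereal_def)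
  have Q0: "Q 0 = 0" by (simp add: Q_def zero_ereal_def)
  have Q_cont: "continuous_on {..0} Q"
    unfolding continuous_on_eq_continuous_within
  proof
    fix r :: real assume r: "r \<in> {..0}"
    have "continuous (at r within {r - 1..0}) Q"
      using Q'[of r "1 - r"] r by (intro DERIV_continuous) auto
    moreover have "at r within {r - 1..0} = at r within {..0}"
      using r by (intro at_within_nhd[of _ "{r - 1<..}"]) auto
    ultimately show "continuous (at r within {..0}) Q" by simp
  qed
  have limits: "((\<lambda>t. \<bar>q t\<bar> / \<bar>t\<bar>) \<longlongrightarrow> 0) at_bot" "((\<lambda>t. 1 / t * Q t) \<longlongrightarrow> 0) at_bot"
    using adm \<omega> unfolding admissible_paths_def q_def Q_def by auto
  have "((\<lambda>t. \<bar>Q t\<bar> / \<bar>t\<bar>) \<longlongrightarrow> 0) at_bot"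
    using tendsto_rabs[OF limits(2)] by (simp add: abs_mult abs_divide)
  then obtain C1 where C1: "\<And>t. t \<le> 0 \<Longrightarrow> \<bar>Q t\<bar> \<le> C1 + \<epsilon> * \<bar>t\<bar>"
    using sublinear_bound[OF Q_cont _ \<open>0 < \<epsilon>\<close>] by blast
  obtain C2 where C2: "\<And>t. t \<le> 0 \<Longrightarrow> \<bar>q t\<bar> \<le> C2 + \<epsilon> * \<bar>t\<bar>"
    using sublinear_bound[OF q limits(1) \<open>0 < \<epsilon>\<close>] by blast
  show ?thesis
    by (rule that[of Q "max C1 C2"]) (use Q' Q0 in \<open>auto intro: order.trans[OF C1] order.trans[OF C2]\<close>)
qed

lemma random_attractor_backwards:
  assumes adm: "admissible_paths P \<Omega>" and \<omega>: "\<omega> \<in> \<Omega>" and "0 \<le> t"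
    and "random_attractor (restrict_space P \<Omega>) \<Xi> A"
  shows "\<Xi> t (path_shift (- t) \<omega>) ` A (path_shift (- t) \<omega>) = A \<omega>"
  using assms admissible_paths_shift[OF adm \<omega>, of "- t"]
  by (simp add: random_attractor_def space_restrict_admissible path_shift_path_shift
      admissible_paths_shift_0)

lemma random_attractor_tempered:
  assumes adm: "admissible_paths P \<Omega>" and \<omega>: "\<omega> \<in> \<Omega>" and "0 < \<rho>"
    and att: "random_attractor (restrict_space P \<Omega>) \<Xi> A"
  obtains t where "0 \<le> t" "\<And>y. y \<in> A (path_shift (- t) \<omega>) \<Longrightarrow> exp (- \<rho> * t) * norm y \<le> 1"
proof -
  have "((\<lambda>t. ennreal (exp (- \<rho> * t)) * (SUP \<phi>\<in>A (path_shift (- t) \<omega>). ennreal (norm \<phi>)))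
      \<longlongrightarrow> 0) at_top"
    using att \<omega> \<open>0 < \<rho>\<close>
    by (simp add: random_attractor_def tempered_universe_def space_restrict_admissible[OF adm])
  then have "\<forall>\<^sub>F t in at_top.
      ennreal (exp (- \<rho> * t)) * (SUP \<phi>\<in>A (path_shift (- t) \<omega>). ennreal (norm \<phi>)) < 1"
    by (rule order_tendstoD(2)) simp
  then have "\<forall>\<^sub>F t in at_top. 0 \<le> t \<and>
      ennreal (exp (- \<rho> * t)) * (SUP \<phi>\<in>A (path_shift (- t) \<omega>). ennreal (norm \<phi>)) < 1"
    using eventually_ge_at_top[of 0] by eventually_elim simp
  then obtain t where t: "0 \<le> t"
    "ennreal (exp (- \<rho> * t)) * (SUP \<phi>\<in>A (path_shift (- t) \<omega>). ennreal (norm \<phi>)) < 1"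
    using eventually_happens'[OF trivial_limit_at_top_linorder] by blast
  show ?thesis
  proof (rule that[OF t(1)])
    fix y assume "y \<in> A (path_shift (- t) \<omega>)"
    then have "ennreal (exp (- \<rho> * t)) * ennreal (norm y) \<le>
        ennreal (exp (- \<rho> * t)) * (SUP \<phi>\<in>A (path_shift (- t) \<omega>). ennreal (norm \<phi>))"
      by (intro mult_left_mono SUP_upper) auto
    also have "\<dots> \<le> 1" using t(2) by simp
    finally show "exp (- \<rho> * t) * norm y \<le> 1"
      by (simp flip: ennreal_mult)
  qed
qed

context truncated_lattice
begin

lemma det_semigroup_eq: "det_semigroup \<iota> m lam \<mu> \<gamma> \<beta> k \<nu> p g = semiflow"
  unfolding det_semigroup_def det_field_eq[abs_def] ..

abbreviation cocycle :: "real \<Rightarrow> real \<Rightarrow> (real \<Rightarrow> real) \<Rightarrow> complex ^ 'n \<Rightarrow> complex ^ 'n" where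
  "cocycle a \<equiv> rand_cocycle \<iota> m lam \<mu> \<gamma> \<beta> k \<nu> p g a"

lemma cocycle_eq: "cocycle a t \<omega> = flow (\<lambda>s. a * OU (path_shift s \<omega>)) t"
  unfolding rand_cocycle_def rand_field_eq[abs_def] ..

text \<open>
  The bound does not depend on \<open>\<omega>\<close>; only the range of admissible \<open>a\<close> does. This matters below,
  where the lemma is applied to a shifted path with a shift that is chosen after the bound.
  The summand \<open>exp 2\<close> comes from the initial value: at a suitable time \<open>-t\<close> in the past,
  temperedness with rate \<open>gap / 4\<close> leaves at most \<open>exp (gap / 2 * t)\<close> of its square, and the decay of
  rate \<open>3 / 4 * gap\<close> beats this.
\<close>

lemma random_attractors_uniformly_bounded:
  assumes adm: "admissible_paths P \<Omega>" and \<omega>: "\<omega> \<in> \<Omega>" and "0 < astar"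
    and att: "\<forall>a\<in>{0<..astar}. random_attractor (restrict_space P \<Omega>) (cocycle a) (A a)"
  shows "\<forall>\<^sub>F a in at_right 0. \<forall>x\<in>A a \<omega>. (norm x)\<^sup>2 \<le> exp 2 + 2 * exp 4 * (norm forcing)\<^sup>2 / gap\<^sup>2"
proof -
  define q where "q r = OU (path_shift r \<omega>)" for r
  have q_cont: "continuous_on UNIV q"
    unfolding q_def by (rule OU_path_continuous[OF adm \<omega>])
  obtain Q C where Q: "\<And>t r. r \<in> {-t..0} \<Longrightarrow> (Q has_real_derivative q r) (at r within {-t..0})"
    "Q 0 = 0"
    and bounds: "\<And>r. r \<le> 0 \<Longrightarrow> \<bar>Q r\<bar> \<le> C + gap / 8 * \<bar>r\<bar>" "\<And>r. r \<le> 0 \<Longrightarrow> \<bar>q r\<bar> \<le> C + gap / 8 * \<bar>r\<bar>"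
    using OU_integral_sublinear[OF adm \<omega>, of "gap / 8"] gap_pos unfolding q_def by auto
  \<comment> \<open>below \<open>a0\<close> the path-dependent constant \<open>C\<close> is scaled down to at most 1\<close>
  define a0 where "a0 = min (min astar 1) (1 / (\<bar>C\<bar> + 1))"
  have "0 < a0" using \<open>0 < astar\<close> by (simp add: a0_def)
  then have "\<forall>\<^sub>F a in at_right 0. a \<in> {0<..<a0}" by (intro eventually_at_right_real)
  then show ?thesis
  proof eventually_elim
    case (elim a)
    then have a: "0 < a" "a \<le> astar" "a \<le> 1" and "a < 1 / (\<bar>C\<bar> + 1)" by (auto simp: a0_def)
    then have "a * (\<bar>C\<bar> + 1) < 1" by (simp add: pos_less_divide_eq)
    then have aC: "a * C \<le> 1"
      using a mult_left_mono[of C "\<bar>C\<bar> + 1" a] by linarith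
    have scaled: "\<bar>a * s\<bar> \<le> 1 + gap / 8 * \<bar>r\<bar>" if "\<bar>s\<bar> \<le> C + gap / 8 * \<bar>r\<bar>" for s r
    proof -
      have "\<bar>a * s\<bar> \<le> a * (C + gap / 8 * \<bar>r\<bar>)"
        using that a by (simp add: abs_mult)
      also have "\<dots> = a * C + a * (gap / 8 * \<bar>r\<bar>)" by (simp add: algebra_simps)
      also have "\<dots> \<le> 1 + 1 * (gap / 8 * \<bar>r\<bar>)"
        using aC a gap_pos by (intro add_mono mult_right_mono) auto
      finally show ?thesis by simp
    qed
    have at_a: "random_attractor (restrict_space P \<Omega>) (cocycle a) (A a)"
      using a att by simp
    have "0 < gap / 4" using gap_pos by simp
    then obtain t where t: "0 \<le> t"
      "\<And>y. y \<in> A a (path_shift (- t) \<omega>) \<Longrightarrow> exp (- (gap / 4) * t) * norm y \<le> 1"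
      using random_attractor_tempered[OF adm \<omega> _ at_a] by blast
    show ?case
    proof
      fix x assume "x \<in> A a \<omega>"
      then obtain y where y: "y \<in> A a (path_shift (- t) \<omega>)"
        "x = cocycle a t (path_shift (- t) \<omega>) y"
        using random_attractor_backwards[OF adm \<omega> t(1) at_a] by blast
      have "x = flow (\<lambda>s. a * q (s - t)) t y"
        by (simp add: y(2) cocycle_eq q_def path_shift_path_shift)
      then have "(norm x)\<^sup>2 \<le> (norm y)\<^sup>2 * exp (2 - 3 / 4 * gap * t) +
          2 * exp 4 * (norm forcing)\<^sup>2 / gap\<^sup>2"
        using pullback_bound[OF a(1) t(1) q_cont Q(1) Q(2) scaled[OF bounds(1)] scaled[OF bounds(2)]]
        by simp
      also have "(norm y)\<^sup>2 * exp (2 - 3 / 4 * gap * t) \<le> exp 2"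
      proof -
        have "(exp (- (gap / 4) * t) * norm y)\<^sup>2 \<le> 1"
          using t(2)[OF y(1)] by (simp add: power_le_one)
        then have y_le: "(norm y)\<^sup>2 * exp (- (gap / 2) * t) \<le> 1"
          by (simp add: power_mult_distrib mult.commute flip: exp_double)
        have "exp (2 - 3 / 4 * gap * t) \<le> exp 2 * exp (- (gap / 2) * t)"
          using gap_pos t(1) by (simp flip: exp_add)
        then have "(norm y)\<^sup>2 * exp (2 - 3 / 4 * gap * t) \<le>
            (norm y)\<^sup>2 * (exp 2 * exp (- (gap / 2) * t))"
          by (rule mult_left_mono) simp
        also have "\<dots> = exp 2 * ((norm y)\<^sup>2 * exp (- (gap / 2) * t))" by simp
        also have "\<dots> \<le> exp 2 * 1" by (rule mult_left_mono) (use y_le in simp_all)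
        finally show ?thesis by simp
      qed
      finally show "(norm x)\<^sup>2 \<le> exp 2 + 2 * exp 4 * (norm forcing)\<^sup>2 / gap\<^sup>2" by simp
    qed
  qed
qed

text \<open>
  A point of the random attractor at \<open>\<omega>\<close> is the image of a point of the ball of radius \<open>R\<close> under the
  cocycle over the time \<open>T\<close>. The time is chosen first, so that the deterministic semiflow carries the ball
  close to the deterministic attractor; then \<open>a\<close> is taken so small that the cocycle is close to the semiflow.
\<close>

lemma random_attractors_upper_semicontinuous:
  assumes adm: "admissible_paths P \<Omega>" and \<omega>: "\<omega> \<in> \<Omega>" and "0 < astar"
    and att: "\<forall>a\<in>{0<..astar}. random_attractor (restrict_space P \<Omega>) (cocycle a) (A a)"
    and global: "global_attractor semiflow A0"
  shows "((\<lambda>a. semidist (A a \<omega>) A0) \<longlongrightarrow> 0) (at_right 0)"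
  unfolding semidist_tendsto_0_iff
proof (intro allI impI)
  fix e :: real assume "0 < e"
  define R where "R = sqrt (exp 2 + 2 * exp 4 * (norm forcing)\<^sup>2 / gap\<^sup>2)"
  have "((\<lambda>t. semidist (semiflow t ` cball 0 R) A0) \<longlongrightarrow> 0) at_top"
    using global unfolding global_attractor_def by blast
  then have "\<forall>\<^sub>F t in at_top. \<forall>y\<in>semiflow t ` cball 0 R. \<exists>b\<in>A0. norm (y - b) < e / 2"
    unfolding semidist_tendsto_0_iff using \<open>0 < e\<close> by (meson half_gt_zero)
  then have "\<forall>\<^sub>F t in at_top. 0 \<le> t \<and> (\<forall>y\<in>semiflow t ` cball 0 R. \<exists>b\<in>A0. norm (y - b) < e / 2)"
    using eventually_ge_at_top[of 0] by eventually_elim simp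
  then obtain T where T: "0 \<le> T" "\<And>y. y \<in> cball 0 R \<Longrightarrow> \<exists>b\<in>A0. norm (semiflow T y - b) < e / 2"
    using eventually_happens'[OF trivial_limit_at_top_linorder] by blast
  let ?\<omega> = "path_shift (- T) \<omega>"
  have \<omega>': "?\<omega> \<in> \<Omega>" by (rule admissible_paths_shift[OF adm \<omega>])
  have "\<forall>\<^sub>F a in at_right 0. \<forall>x\<in>cball 0 R. norm (cocycle a T ?\<omega> x - semiflow T x) < e / 2"
    unfolding cocycle_eq
    using \<open>0 < e\<close> by (intro flow_tends_to_semiflow OU_path_continuous[OF adm \<omega>'] T(1)) simp
  moreover have "\<forall>\<^sub>F a in at_right 0. \<forall>y\<in>A a ?\<omega>. y \<in> cball 0 R"
    using random_attractors_uniformly_bounded[OF adm \<omega>' \<open>0 < astar\<close> att]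
    by eventually_elim (auto simp: R_def intro: real_le_rsqrt)
  moreover have "\<forall>\<^sub>F a in at_right 0. a \<in> {0<..<astar}"
    using \<open>0 < astar\<close> by (rule eventually_at_right_real)
  ultimately show "\<forall>\<^sub>F a in at_right 0. \<forall>x\<in>A a \<omega>. \<exists>b\<in>A0. norm (x - b) < e"
  proof eventually_elim
    case (elim a)
    show ?case
    proof
      fix x assume "x \<in> A a \<omega>"
      then obtain y where y: "y \<in> A a ?\<omega>" "x = cocycle a T ?\<omega> y"
        using random_attractor_backwards[OF adm \<omega> T(1) bspec[OF att, of a]] elim(3) by force
      then have "y \<in> cball 0 R" using elim(2) by blast
      then obtain b where b: "b \<in> A0" "norm (semiflow T y - b) < e / 2" using T(2) by blast
      have "norm (x - b) \<le> norm (x - semiflow T y) + norm (semiflow T y - b)"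
        using norm_triangle_ineq[of "x - semiflow T y" "semiflow T y - b"] by simp
      also have "\<dots> < e / 2 + e / 2"
        using elim(1) \<open>y \<in> cball 0 R\<close> b(2) y(2) by (intro add_strict_mono) auto
      finally show "\<exists>b\<in>A0. norm (x - b) < e" using b(1) by auto
    qed
  qed
qed

end

theorem theorem5p4:
  fixes m :: nat and \<iota> :: "'n::finite \<Rightarrow> int"
    and lam \<mu> \<gamma> \<beta> k \<nu> p :: real and g :: "int \<Rightarrow> complex"
  assumes "bij_betw \<iota> UNIV {- int m..int m}"
    and "lam > 0" and "\<gamma> > 0" and "k > 0" and "p > 0" and "\<gamma> > 4 * lam"
    and "(\<lambda>j. norm (g j) powr ((p + 2) / (p + 1))) summable_on UNIV"
  shows "\<exists>\<A>. global_attractor (det_semigroup \<iota> m lam \<mu> \<gamma> \<beta> k \<nu> p g) \<A> \<and>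
    (\<forall>P \<Omega> (astar::real) (\<A>r :: real \<Rightarrow> (real \<Rightarrow> real) \<Rightarrow> (complex ^ 'n) set).
       wiener_measure P \<longrightarrow> admissible_paths P \<Omega> \<longrightarrow> astar > 0 \<longrightarrow>
       (\<forall>a\<in>{0<..astar}. random_attractor (restrict_space P \<Omega>)
          (rand_cocycle \<iota> m lam \<mu> \<gamma> \<beta> k \<nu> p g a) (\<A>r a)) \<longrightarrow>
       (\<forall>\<omega>\<in>\<Omega>. ((\<lambda>a. semidist (\<A>r a \<omega>) \<A>) \<longlongrightarrow> 0) (at_right 0)))"
proof -
  interpret truncated_lattice m \<iota> lam \<mu> \<gamma> \<beta> k \<nu> p g
    using assms by unfold_locales auto
  obtain A where A: "global_attractor semiflow A" using exists_semiflow_attractor by blast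
  then have "global_attractor (det_semigroup \<iota> m lam \<mu> \<gamma> \<beta> k \<nu> p g) A"
    by (simp only: det_semigroup_eq)
  then show ?thesis
    using random_attractors_upper_semicontinuous[OF _ _ _ _ A] by blast
qed

end
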